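(* Two planar convex polygons (convex hulls of finitely many points of $\mathbb{R}^2$, with nonempty interior) are $\mathcal{L}_{\mathrm{B}}$-elementarily equivalent if and only if they are projectively equivalent.
   Context: $\mathcal{L}_{\mathrm{B}}$ is the first-order language with a single ternary relation symbol $B$. A convex set $K\subseteq\mathbb{R}^2$ is an $\mathcal{L}_{\mathrm{B}}$-structure with universe $K$, where $B(a,x,b)$ holds iff $x\in[a,b]$ (the closed segment). Two structures are $\mathcal{L}_{\mathrm{B}}$-elementarily equivalent if they satisfy the same first-order $\mathcal{L}_{\mathrm{B}}$-sentences. Convex sets $K,K'\subseteq\mathbb{R}^2\subseteq\mathbb{RP}^2$ are projectively equivalent if there is $T\in\mathrm{PGL}_3(\mathbb{R})$ whose singular line (the preimage of the line at infinity) is disjoint from $K$ and with $T(K)=K'$. *)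

theory Defs
  imports "HOL-Analysis.Analysis"
begin

section \<open>First-order logic over one ternary relation symbol\<close>

text \<open>Variables are named by natural numbers; equality is a logical symbol.  The remaining
  connectives and the universal quantifier are expressible from those below.\<close>

datatype fm =
    Eq nat nat
  | Bet nat nat nat
  | Neg fm
  | Conj fm fm
  | Ex nat fm

primrec free_vars :: "fm \<Rightarrow> nat set" where
  "free_vars (Eq i j) = {i, j}"
| "free_vars (Bet i j k) = {i, j, k}"
| "free_vars (Neg \<phi>) = free_vars \<phi>"
| "free_vars (Conj \<phi> \<psi>) = free_vars \<phi> \<union> free_vars \<psi>"
| "free_vars (Ex i \<phi>) = free_vars \<phi> - {i}"

definition sentence :: "fm \<Rightarrow> bool" where
  "sentence \<phi> \<longleftrightarrow> free_vars \<phi> = {}"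

text \<open>A structure is a pair of a universe and an interpretation of the relation symbol; only
  the restriction of the interpretation to the universe matters.\<close>

type_synonym 'a struct = "'a set \<times> ('a \<Rightarrow> 'a \<Rightarrow> 'a \<Rightarrow> bool)"

primrec sat :: "'a struct \<Rightarrow> (nat \<Rightarrow> 'a) \<Rightarrow> fm \<Rightarrow> bool" where
  "sat M e (Eq i j) \<longleftrightarrow> e i = e j"
| "sat M e (Bet i j k) \<longleftrightarrow> snd M (e i) (e j) (e k)"
| "sat M e (Neg \<phi>) \<longleftrightarrow> \<not> sat M e \<phi>"
| "sat M e (Conj \<phi> \<psi>) \<longleftrightarrow> sat M e \<phi> \<and> sat M e \<psi>"
| "sat M e (Ex i \<phi>) \<longleftrightarrow> (\<exists>x\<in>fst M. sat M (e(i := x)) \<phi>)"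

definition models :: "'a struct \<Rightarrow> fm \<Rightarrow> bool" where
  "models M \<phi> \<longleftrightarrow> (\<forall>e. range e \<subseteq> fst M \<longrightarrow> sat M e \<phi>)"

definition elementarily_equivalent :: "'a struct \<Rightarrow> 'b struct \<Rightarrow> bool" where
  "elementarily_equivalent M N \<longleftrightarrow> (\<forall>\<phi>. sentence \<phi> \<longrightarrow> (models M \<phi> \<longleftrightarrow> models N \<phi>))"

definition betweenness_struct :: "(real^2) set \<Rightarrow> (real^2) struct" where
  "betweenness_struct K = (K, \<lambda>a x b. x \<in> closed_segment a b)"

section \<open>The real projective plane\<close>

text \<open>Points of the projective plane are the lines through the origin of \<open>\<real>\<^sup>3\<close>.  The affine
  plane is embedded as the points with homogeneous coordinates \<open>[x : y : 1]\<close>.\<close>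

definition RP2 :: "(real^3) set set" where
  "RP2 = {span {v} | v. v \<noteq> 0}"

definition affine_point :: "real^2 \<Rightarrow> (real^3) set" where
  "affine_point p = span {vector [p$1, p$2, 1]}"

definition line_at_infinity :: "(real^3) set set" where
  "line_at_infinity = {L \<in> RP2. \<forall>v\<in>L. v$3 = 0}"

text \<open>Elements of the projective linear group are identified with the transformations of the
  projective plane that they induce; two invertible matrices induce the same one iff they
  are proportional.\<close>

definition PGL3 :: "((real^3) set \<Rightarrow> (real^3) set) set" where
  "PGL3 = {restrict (\<lambda>L. (\<lambda>v. A *v v) ` L) RP2 | A :: real^3^3. invertible A}"

definition singular_line :: "((real^3) set \<Rightarrow> (real^3) set) \<Rightarrow> (real^3) set set" where
  "singular_line T = {L \<in> RP2. T L \<in> line_at_infinity}"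

definition projectively_equivalent :: "(real^2) set \<Rightarrow> (real^2) set \<Rightarrow> bool" where
  "projectively_equivalent K K' \<longleftrightarrow>
     (\<exists>T\<in>PGL3. singular_line T \<inter> affine_point ` K = {} \<and>
               T ` (affine_point ` K) = affine_point ` K')"

definition convex_polygon :: "(real^2) set \<Rightarrow> bool" where
  "convex_polygon P \<longleftrightarrow> polytope P \<and> interior P \<noteq> {}"

end

theory Submission
  imports Defs
begin

text \<open>Since a polygon has finitely many vertices, elementary equivalence yields a bijection between
  the two vertex sets that preserves all first-order formulas.  Such a bijection preserves cross
  ratios of the points in which diagonals cross: harmonic conjugates are definable by a figure that
  stays inside the polygon, so the coordinate of a point on a diagonal is determined by its type
  through repeated bisection.  With four vertices spanning three consecutive edges as a projective
  frame, every other vertex is determined by two such cross ratios.  Conversely, a projective map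
  whose singular line misses a convex set preserves betweenness.\<close>

section \<open>Types of tuples and algebraic extensions\<close>

text \<open>Elementarily equivalent structures need not realise the same types, so tuples are never
  extended by saturation: every new point is taken as a solution of a formula with finitely many
  solutions in the target structure (a vertex, a crossing of diagonals, a harmonic midpoint). A
  projective map rescales the coordinate of \<open>pt\<close> by a constant on each diagonal, so a
  type cannot determine that coordinate itself. Only the quotient of two coordinates on one diagonal
  is invariant, and the crossing of the two diagonals of the frame is the reference point on both.
  Positivity of scale factors is the second concern. A linear map that sends the lift of each vertex
  to a positive multiple of a lift keeps its singular line off the whole hull, whereas mixed signs
  would let that line cut the polygon. Hence coordinates of vertices are computed up to positive
  factors, not merely up to nonzero ones. A triangle has no fourth vertex to complete the frame,
  which makes it a separate case.\<close>

lemma sat_cong: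
  assumes "\<And>i. i \<in> free_vars \<phi> \<Longrightarrow> e i = e' i"
  shows "sat M e \<phi> = sat M e' \<phi>"
  using assms
proof (induction \<phi> arbitrary: e e')
  case (Ex i \<phi>)
  have "sat M (e(i := x)) \<phi> = sat M (e'(i := x)) \<phi>" for x
    by (rule Ex.IH) (use Ex.prems in auto)
  then show ?case by simp
next
  case (Conj \<phi> \<psi>)
  have "sat M e \<phi> = sat M e' \<phi>" by (rule Conj.IH) (use Conj.prems in auto)
  moreover have "sat M e \<psi> = sat M e' \<psi>" by (rule Conj.IH) (use Conj.prems in auto)
  ultimately show ?case by simp
next
  case (Neg \<phi>)
  have "sat M e \<phi> = sat M e' \<phi>"
    by (rule Neg.IH) (use Neg.prems in auto)
  then show ?case by simp
qed auto

lemma models_sentence: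
  assumes "sentence \<phi>" "fst M \<noteq> {}"
  shows "models M \<phi> \<longleftrightarrow> sat M e \<phi>"
proof -
  obtain a where a: "a \<in> fst M" using assms(2) by blast
  have eq: "sat M e1 \<phi> = sat M e2 \<phi>" for e1 e2
    by (rule sat_cong) (use assms(1) in \<open>simp add: sentence_def\<close>)
  show ?thesis
  proof
    assume "models M \<phi>"
    then have "sat M (\<lambda>_. a) \<phi>" using a by (auto simp: models_def)
    then show "sat M e \<phi>" using eq by blast
  next
    assume "sat M e \<phi>"
    then show "models M \<phi>" unfolding models_def using eq by blast
  qed
qed

text \<open>Only the free variables are confined to \<open>S\<close>; bound variables may have any
  name. For nonempty structures the case of empty \<open>S\<close> is elementary equivalence, and
  \<open>S\<close> grows by one variable with each added point.\<close>

definition same_type ::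
  "nat set \<Rightarrow> 'a struct \<Rightarrow> (nat \<Rightarrow> 'a) \<Rightarrow> 'b struct \<Rightarrow> (nat \<Rightarrow> 'b) \<Rightarrow> bool" where
  "same_type S M e N e' \<longleftrightarrow> (\<forall>\<phi>. free_vars \<phi> \<subseteq> S \<longrightarrow> sat M e \<phi> = sat N e' \<phi>)"

lemma same_typeD:
  "same_type S M e N e' \<Longrightarrow> free_vars \<phi> \<subseteq> S \<Longrightarrow> sat M e \<phi> \<longleftrightarrow> sat N e' \<phi>"
  by (simp add: same_type_def)

lemma same_type_sym: "same_type S M e N e' \<Longrightarrow> same_type S N e' M e"
  by (simp add: same_type_def)

lemma same_type_empty:
  assumes "elementarily_equivalent M N" "fst M \<noteq> {}" "fst N \<noteq> {}"
  shows "same_type {} M e N e'"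
  unfolding same_type_def
proof (intro allI impI)
  fix \<phi> :: fm
  assume "free_vars \<phi> \<subseteq> {}"
  then have "sentence \<phi>" by (simp add: sentence_def)
  then show "sat M e \<phi> = sat N e' \<phi>"
    using assms models_sentence[of \<phi> M e] models_sentence[of \<phi> N e']
    by (simp add: elementarily_equivalent_def)
qed

text \<open>If no solution in \<open>N\<close> of the algebraic formula \<open>\<psi>\<close> had the type of \<open>x\<close>, a finite conjunction
  of the separating formulas would be realised by \<open>x\<close> and by no element of \<open>N\<close>.\<close>

lemma same_type_extend:
  assumes ty: "same_type S M e N e'" and fv: "free_vars \<psi> \<subseteq> insert j S"
    and x: "x \<in> fst M" "sat M (e(j := x)) \<psi>"
    and fin: "finite {y \<in> fst N. sat N (e'(j := y)) \<psi>}"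
  shows "\<exists>y\<in>fst N. sat N (e'(j := y)) \<psi> \<and>
    same_type (insert j S) M (e(j := x)) N (e'(j := y))"
proof (rule ccontr)
  assume contra: "\<not> ?thesis"
  have sep: "\<exists>\<phi>. free_vars \<phi> \<subseteq> insert j S \<and> sat M (e(j := x)) \<phi> \<and> \<not> sat N (e'(j := y)) \<phi>"
    if y: "y \<in> {y \<in> fst N. sat N (e'(j := y)) \<psi>}" for y
  proof -
    obtain \<phi> where \<phi>: "free_vars \<phi> \<subseteq> insert j S" "sat M (e(j := x)) \<phi> \<noteq> sat N (e'(j := y)) \<phi>"
      using y contra unfolding same_type_def by blast
    show ?thesis
    proof (cases "sat M (e(j := x)) \<phi>")
      case True
      with \<phi> show ?thesis by blast
    next
      case False
      with \<phi> show ?thesis by (intro exI[of _ "Neg \<phi>"]) auto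
    qed
  qed
  have "\<exists>\<theta>. free_vars \<theta> \<subseteq> insert j S \<and> sat M (e(j := x)) \<theta> \<and> (\<forall>y\<in>Y. \<not> sat N (e'(j := y)) \<theta>)"
    if "finite Y" "Y \<subseteq> {y \<in> fst N. sat N (e'(j := y)) \<psi>}" for Y
    using that
  proof (induction Y rule: finite_induct)
    case empty
    \<comment> \<open>\<open>fm\<close> has no constant for truth, so \<open>\<psi>\<close> itself,
      which \<open>x\<close> satisfies, serves as the empty conjunction.\<close>
    then show ?case using fv x(2) by blast
  next
    case (insert y Y)
    obtain \<theta> where \<theta>: "free_vars \<theta> \<subseteq> insert j S" "sat M (e(j := x)) \<theta>"
      "\<forall>y\<in>Y. \<not> sat N (e'(j := y)) \<theta>"
      using insert by blast
    obtain \<phi> where "free_vars \<phi> \<subseteq> insert j S" "sat M (e(j := x)) \<phi>" "\<not> sat N (e'(j := y)) \<phi>"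
      using sep[of y] insert.prems by blast
    with \<theta> show ?case
      by (intro exI[of _ "Conj \<phi> \<theta>"]) (auto simp del: fun_upd_apply)
  qed
  from this[OF fin order_refl] obtain \<theta> where \<theta>: "free_vars \<theta> \<subseteq> insert j S"
    "sat M (e(j := x)) \<theta>" "\<forall>y\<in>{y \<in> fst N. sat N (e'(j := y)) \<psi>}. \<not> sat N (e'(j := y)) \<theta>"
    by blast
  have "sat M e (Ex j (Conj \<psi> \<theta>))" using x \<theta>(2) by auto
  then have "sat N e' (Ex j (Conj \<psi> \<theta>))"
    using same_typeD[OF ty, of "Ex j (Conj \<psi> \<theta>)"] fv \<theta>(1) by auto
  then show False using \<theta>(3) by auto
qed

lemma elementarily_equivalent_iso:
  assumes bij: "bij_betw f (fst M) (fst N)"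
    and rel: "\<And>a x b. a \<in> fst M \<Longrightarrow> x \<in> fst M \<Longrightarrow> b \<in> fst M \<Longrightarrow>
      snd M a x b \<longleftrightarrow> snd N (f a) (f x) (f b)"
    and ne: "fst M \<noteq> {}"
  shows "elementarily_equivalent M N"
proof -
  have inj: "f a = f b \<longleftrightarrow> a = b" if "a \<in> fst M" "b \<in> fst M" for a b
    using bij that by (auto simp: bij_betw_def inj_on_def)
  have im: "f ` fst M = fst N" using bij by (simp add: bij_betw_def)
  have iso: "sat M e \<phi> = sat N (f \<circ> e) \<phi>" if "range e \<subseteq> fst M" for e \<phi>
    using that
  proof (induction \<phi> arbitrary: e)
    case (Ex i \<phi>)
    have "sat M (e(i := x)) \<phi> = sat N ((f \<circ> e)(i := f x)) \<phi>" if "x \<in> fst M" for x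
    proof -
      have "range (e(i := x)) \<subseteq> fst M" using Ex.prems that by auto
      moreover have "f \<circ> e(i := x) = (f \<circ> e)(i := f x)" by auto
      ultimately show ?thesis using Ex.IH[of "e(i := x)"] by metis
    qed
    then show ?case unfolding sat.simps im[symmetric] by blast
  next
    case (Eq i j)
    then show ?case using inj[of "e i" "e j"] by auto
  next
    case (Bet i j k)
    then show ?case using rel[of "e i" "e j" "e k"] by auto
  qed auto
  obtain a where a: "a \<in> fst M" using ne by blast
  show ?thesis unfolding elementarily_equivalent_def
  proof (intro allI impI)
    fix \<phi> assume \<phi>: "sentence \<phi>"
    have "fst N \<noteq> {}" using im ne by blast
    then show "models M \<phi> \<longleftrightarrow> models N \<phi>"
      using iso[of "\<lambda>_. a" \<phi>] a models_sentence[OF \<phi>, of M "\<lambda>_. a"] ne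
        models_sentence[OF \<phi>, of N "f \<circ> (\<lambda>_. a)"] by auto
  qed
qed

section \<open>Homogeneous coordinates\<close>

text \<open>The constant third coordinate makes every linear relation among lifts also a relation
  among its coefficients, so affine weights need not be carried separately.\<close>

definition lift :: "real^2 \<Rightarrow> real^3" where
  "lift p = vector [p$1, p$2, 1]"

lemma lift_nth [simp]: "lift p $ 1 = p $ 1" "lift p $ 2 = p $ 2" "lift p $ 3 = 1"
  by (simp_all add: lift_def)

lemma lift_eq_iff [simp]: "lift p = lift q \<longleftrightarrow> p = q"
  by (auto simp: vec_eq_iff forall_3 forall_2)

lemma lift_nonzero [simp]: "lift p \<noteq> 0"
  by (metis lift_nth(3) zero_index zero_neq_one)

lemma lift_scaleR_eq:
  assumes "c *\<^sub>R lift p = d *\<^sub>R lift q" "c \<noteq> 0 \<or> d \<noteq> 0"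
  shows "p = q"
proof -
  have "c = d" using arg_cong[OF assms(1), of "\<lambda>v. v $ 3"] by simp
  then show ?thesis using assms by simp
qed

lemma lift_exists:
  assumes "v $ 3 > 0"
  obtains p where "lift p = (1 / v $ 3) *\<^sub>R v"
proof
  show "lift (vector [v$1 / v$3, v$2 / v$3]) = (1 / v $ 3) *\<^sub>R v"
    using assms by (simp add: vec_eq_iff forall_3)
qed

text \<open>The third coordinate forces \<alpha> + \<beta> = 1, so a segment becomes a cone. Cones,
  unlike convex combinations, are compatible with arbitrary linear maps and with rescaling.\<close>

lemma closed_segment_lift:
  "x \<in> closed_segment a b \<longleftrightarrow>
    (\<exists>\<alpha>\<ge>0. \<exists>\<beta>\<ge>0. lift x = \<alpha> *\<^sub>R lift a + \<beta> *\<^sub>R lift b)"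
proof
  assume "x \<in> closed_segment a b"
  then obtain u where "0 \<le> u" "u \<le> 1" "x = (1 - u) *\<^sub>R a + u *\<^sub>R b"
    by (auto simp: in_segment)
  then show "\<exists>\<alpha>\<ge>0. \<exists>\<beta>\<ge>0. lift x = \<alpha> *\<^sub>R lift a + \<beta> *\<^sub>R lift b"
    by (intro exI[of _ "1 - u"] conjI exI[of _ u]) (auto simp: vec_eq_iff forall_3)
next
  assume "\<exists>\<alpha>\<ge>0. \<exists>\<beta>\<ge>0. lift x = \<alpha> *\<^sub>R lift a + \<beta> *\<^sub>R lift b"
  then obtain \<alpha> \<beta> where ab: "\<alpha> \<ge> 0" "\<beta> \<ge> 0" "lift x = \<alpha> *\<^sub>R lift a + \<beta> *\<^sub>R lift b" by blast
  have s: "\<alpha> = 1 - \<beta>" using arg_cong[OF ab(3), of "\<lambda>v. v $ 3"] by simp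
  have "x = (1 - \<beta>) *\<^sub>R a + \<beta> *\<^sub>R b"
    using arg_cong[OF ab(3), of "\<lambda>v. v $ 1"] arg_cong[OF ab(3), of "\<lambda>v. v $ 2"] s
    by (simp add: vec_eq_iff forall_2)
  then show "x \<in> closed_segment a b" using ab s by (auto simp: in_segment)
qed

lemma closed_segment_liftI:
  assumes "c *\<^sub>R lift x = \<alpha> *\<^sub>R lift a + \<beta> *\<^sub>R lift b" "\<alpha> \<ge> 0" "\<beta> \<ge> 0" "c > 0"
  shows "x \<in> closed_segment a b"
proof -
  have "(1 / c) *\<^sub>R (c *\<^sub>R lift x) = (\<alpha> / c) *\<^sub>R lift a + (\<beta> / c) *\<^sub>R lift b"
    unfolding assms(1) by (simp add: scaleR_right_distrib)
  then have "lift x = (\<alpha> / c) *\<^sub>R lift a + (\<beta> / c) *\<^sub>R lift b"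
    using assms(4) by simp
  then show ?thesis unfolding closed_segment_lift
    using assms by (intro exI[of _ "\<alpha> / c"] conjI exI[of _ "\<beta> / c"]) auto
qed

text \<open>Noncollinearity, phrased through betweenness alone so that it can be written as a
  formula: of three collinear points one lies between the other two.\<close>

definition triangle :: "real^2 \<Rightarrow> real^2 \<Rightarrow> real^2 \<Rightarrow> bool" where
  "triangle a b c \<longleftrightarrow>
    a \<notin> closed_segment b c \<and> b \<notin> closed_segment a c \<and> c \<notin> closed_segment a b"

text \<open>Two of any three reals have a nonnegative product. If the third coefficient were
  nonzero, solving for its point would put that point in the segment of the other two; so it
  vanishes, and then all products with it are 0 and the same argument removes the rest.\<close>

lemma triangle_independent:
  assumes "triangle a b c" "x *\<^sub>R lift a + y *\<^sub>R lift b + z *\<^sub>R lift c = 0"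
  shows "x = 0" "y = 0" "z = 0"
proof -
  have key: "u = 0" if "p \<notin> closed_segment q r" "v * w \<ge> 0"
    "u *\<^sub>R lift p + v *\<^sub>R lift q + w *\<^sub>R lift r = 0" for p q r :: "real^2" and u v w :: real
  proof (rule ccontr)
    assume u: "u \<noteq> 0"
    have sum: "u + v + w = 0" using arg_cong[OF that(3), of "\<lambda>v. v $ 3"] by simp
    have e: "u *\<^sub>R lift p = (-v) *\<^sub>R lift q + (-w) *\<^sub>R lift r"
      using that(3) by (simp add: algebra_simps eq_neg_iff_add_eq_0)
    have "lift p = (1/u) *\<^sub>R (u *\<^sub>R lift p)" using u by simp
    also have "\<dots> = (-v/u) *\<^sub>R lift q + (-w/u) *\<^sub>R lift r"
      unfolding e scaleR_right_distrib by simp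
    finally have *: "lift p = (-v/u) *\<^sub>R lift q + (-w/u) *\<^sub>R lift r" .
    have "-v/u \<ge> 0 \<and> -w/u \<ge> 0"
      using that(2) sum u by (cases "u > 0") (auto simp: zero_le_mult_iff field_simps)
    with * that(1) show False unfolding closed_segment_lift by blast
  qed
  have sum: "x + y + z = 0" using arg_cong[OF assms(2), of "\<lambda>v. v $ 3"] by simp
  have e1: "y *\<^sub>R lift b + x *\<^sub>R lift a + z *\<^sub>R lift c = 0"
    and e2: "z *\<^sub>R lift c + x *\<^sub>R lift a + y *\<^sub>R lift b = 0"
    using assms(2) by (simp_all add: algebra_simps)
  note n = assms(1)[unfolded triangle_def]
  have X: "y * z \<ge> 0 \<Longrightarrow> x = 0" using key[of a b c y z x] n assms(2) by blast
  have Y: "x * z \<ge> 0 \<Longrightarrow> y = 0" using key[of b a c x z y] n e1 by blast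
  have Z: "x * y \<ge> 0 \<Longrightarrow> z = 0" using key[of c a b x y z] n e2 by blast
  have "x * y \<ge> 0 \<or> y * z \<ge> 0 \<or> x * z \<ge> 0"
    unfolding zero_le_mult_iff by linarith
  then have "x = 0 \<or> y = 0 \<or> z = 0" using X Y Z by blast
  then have "x = 0 \<and> y = 0 \<and> z = 0"
    using X Y Z sum by (metis add.left_neutral add.right_neutral mult_zero_left mult_zero_right order_refl)
  then show "x = 0" "y = 0" "z = 0" by auto
qed

lemma triangle_coords_unique:
  assumes "triangle a b c"
    and "x *\<^sub>R lift a + y *\<^sub>R lift b + z *\<^sub>R lift c = x' *\<^sub>R lift a + y' *\<^sub>R lift b + z' *\<^sub>R lift c"
  shows "x = x' \<and> y = y' \<and> z = z'"
proof -
  have "(x - x') *\<^sub>R lift a + (y - y') *\<^sub>R lift b + (z - z') *\<^sub>R lift c = 0"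
    using assms(2) by (simp add: algebra_simps)
  from triangle_independent[OF assms(1) this] show ?thesis by auto
qed

section \<open>Harmonic midpoints\<close>

text \<open>The projective coordinate \<open>s\<close> on the segment from \<open>a\<close> to \<open>b\<close> in which \<open>a\<close> is \<open>0\<close> and \<open>b\<close> is
  \<open>\<infinity>\<close>.\<close>

definition pt :: "real^2 \<Rightarrow> real^2 \<Rightarrow> real \<Rightarrow> real^2" where
  "pt a b s = (1 / (1 + s)) *\<^sub>R (a + s *\<^sub>R b)"

lemma lift_pt: "s \<ge> 0 \<Longrightarrow> (1 + s) *\<^sub>R lift (pt a b s) = lift a + s *\<^sub>R lift b"
  by (simp add: vec_eq_iff forall_3 pt_def add_nonneg_eq_0_iff)

lemma lift_pt_scaled:
  "s \<ge> 0 \<Longrightarrow> (c * (1 + s)) *\<^sub>R lift (pt a b s) = c *\<^sub>R lift a + (c * s) *\<^sub>R lift b"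
  using lift_pt[of s a b] by (metis scaleR_scaleR scaleR_right_distrib)

lemma pt_0 [simp]: "pt a b 0 = a"
  by (simp add: pt_def)

lemma pt_eqI:
  assumes "c *\<^sub>R lift p = d *\<^sub>R (lift a + s *\<^sub>R lift b)" "s \<ge> 0" "c > 0"
  shows "p = pt a b s"
proof -
  have "c *\<^sub>R lift p = (d * (1 + s)) *\<^sub>R lift (pt a b s)"
    using assms lift_pt[of s a b] by (metis scaleR_scaleR)
  then show ?thesis using lift_scaleR_eq assms(3) by blast
qed

lemma pt_swap: "s > 0 \<Longrightarrow> pt a b s = pt b a (1 / s)"
  by (rule pt_eqI[of "1 + s" _ s])
    (simp_all add: lift_pt scaleR_right_distrib add.commute)

lemma lift_indep2:
  assumes "a \<noteq> b" "x *\<^sub>R lift a + y *\<^sub>R lift b = x' *\<^sub>R lift a + y' *\<^sub>R lift b"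
  shows "x = x' \<and> y = y'"
proof -
  have "(x - x') *\<^sub>R lift a = (y' - y) *\<^sub>R lift b"
    using assms(2) by (simp add: algebra_simps)
  from lift_scaleR_eq[OF this] assms(1) show ?thesis by auto
qed

lemma pt_between_iff:
  assumes "a \<noteq> b" "0 \<le> x" "x \<le> y" "0 \<le> t"
  shows "pt a b t \<in> closed_segment (pt a b x) (pt a b y) \<longleftrightarrow> x \<le> t \<and> t \<le> y"
proof
  assume "pt a b t \<in> closed_segment (pt a b x) (pt a b y)"
  then obtain \<alpha> \<beta> where ab: "\<alpha> \<ge> 0" "\<beta> \<ge> 0"
    "lift (pt a b t) = \<alpha> *\<^sub>R lift (pt a b x) + \<beta> *\<^sub>R lift (pt a b y)"
    unfolding closed_segment_lift by blast
  \<comment> \<open>Absorbing the normalising factors \<open>1 + s\<close> makes the comparison in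
    the basis \<open>lift a\<close>, \<open>lift b\<close> say that \<open>t\<close> is a convex
    combination of \<open>x\<close> and \<open>y\<close>.\<close>
  define \<alpha>' \<beta>' where "\<alpha>' = (1 + t) * \<alpha> / (1 + x)" and "\<beta>' = (1 + t) * \<beta> / (1 + y)"
  have nn: "\<alpha>' \<ge> 0" "\<beta>' \<ge> 0" unfolding \<alpha>'_def \<beta>'_def using ab assms by auto
  have "(1 + t) *\<^sub>R lift (pt a b t) = \<alpha>' *\<^sub>R ((1 + x) *\<^sub>R lift (pt a b x)) + \<beta>' *\<^sub>R ((1 + y) *\<^sub>R lift (pt a b y))"
    using assms by (simp add: ab(3) \<alpha>'_def \<beta>'_def scaleR_right_distrib)
  then have "lift a + t *\<^sub>R lift b = \<alpha>' *\<^sub>R (lift a + x *\<^sub>R lift b) + \<beta>' *\<^sub>R (lift a + y *\<^sub>R lift b)"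
    using assms by (simp only: lift_pt)
  then have "1 *\<^sub>R lift a + t *\<^sub>R lift b = (\<alpha>' + \<beta>') *\<^sub>R lift a + (\<alpha>' * x + \<beta>' * y) *\<^sub>R lift b"
    by (simp add: algebra_simps)
  from lift_indep2[OF assms(1) this] have e: "\<alpha>' = 1 - \<beta>'" "t = \<alpha>' * x + \<beta>' * y" by auto
  have "t = x + \<beta>' * (y - x)" "t = y - \<alpha>' * (y - x)" using e by algebra+
  moreover have "\<beta>' * (y - x) \<ge> 0" "\<alpha>' * (y - x) \<ge> 0" using nn assms(3) by simp_all
  ultimately show "x \<le> t \<and> t \<le> y" by linarith
next
  assume t: "x \<le> t \<and> t \<le> y"
  show "pt a b t \<in> closed_segment (pt a b x) (pt a b y)"
  proof (cases "x = y")
    case True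
    then have "t = y" "x = y" using t by auto
    then show ?thesis by simp
  next
    case False
    have "((y - x) * (1 + t)) *\<^sub>R lift (pt a b t) =
        ((y - t) * (1 + x)) *\<^sub>R lift (pt a b x) + ((t - x) * (1 + y)) *\<^sub>R lift (pt a b y)"
      unfolding lift_pt_scaled[OF assms(4)] lift_pt_scaled[OF assms(2)]
        lift_pt_scaled[OF order_trans[OF assms(2,3)]]
      by (simp add: algebra_simps)
    then show ?thesis
      by (rule closed_segment_liftI) (use t False assms in auto)
  qed
qed

lemma pt_in_segment: "s \<ge> 0 \<Longrightarrow> pt a b s \<in> closed_segment a b"
  by (rule closed_segment_liftI[of "1 + s" _ 1 _ s]) (simp_all add: lift_pt)

lemma segment_pt:
  assumes "p \<in> closed_segment a b" "p \<noteq> b"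
  obtains s where "s \<ge> 0" "p = pt a b s"
proof -
  obtain \<alpha> \<beta> where ab: "\<alpha> \<ge> 0" "\<beta> \<ge> 0" "lift p = \<alpha> *\<^sub>R lift a + \<beta> *\<^sub>R lift b"
    using assms(1) unfolding closed_segment_lift by blast
  have "\<alpha> \<noteq> 0"
  proof
    assume "\<alpha> = 0"
    then have "1 *\<^sub>R lift p = \<beta> *\<^sub>R lift b" using ab by simp
    from lift_scaleR_eq[OF this] assms(2) show False by simp
  qed
  then have "1 *\<^sub>R lift p = \<alpha> *\<^sub>R (lift a + (\<beta> / \<alpha>) *\<^sub>R lift b)"
    by (simp add: ab(3) scaleR_right_distrib)
  then have "p = pt a b (\<beta> / \<alpha>)"
    by (rule pt_eqI) (use ab in auto)
  with that[of "\<beta> / \<alpha>"] ab show ?thesis by simp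
qed

text \<open>The complete quadrilateral construction. In the quadrangle \<open>x\<close>,
  \<open>y\<close>, \<open>g\<close>, \<open>f\<close> the sides \<open>x y\<close> and
  \<open>f g\<close> meet in \<open>b\<close>, the sides \<open>x f\<close> and \<open>y g\<close>
  meet in \<open>u\<close>, and the diagonals meet in \<open>h\<close>; so the line
  \<open>u h\<close> cuts \<open>x y\<close> in the harmonic conjugate \<open>z\<close> of
  \<open>b\<close>. Using segments instead of lines keeps the figure inside a convex set, and
  \<open>f \<noteq> u\<close>, \<open>f \<noteq> x\<close> exclude its degenerate forms.\<close>

definition mid_figure :: "(real^2) set \<Rightarrow> real^2 \<Rightarrow> real^2 \<Rightarrow> real^2 \<Rightarrow> real^2 \<Rightarrow> bool" where
  "mid_figure K x y b z \<longleftrightarrow> (\<exists>u\<in>K. \<exists>f\<in>K. \<exists>g\<in>K. \<exists>h\<in>K. triangle u x b \<and> f \<noteq> u \<and> f \<noteq> x \<and>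
     f \<in> closed_segment u x \<and> g \<in> closed_segment f b \<and> g \<in> closed_segment u y \<and>
     h \<in> closed_segment x g \<and> h \<in> closed_segment y f \<and>
     h \<in> closed_segment u z \<and> z \<in> closed_segment x y)"

section \<open>Signed areas: \<open>orient a b c\<close> is twice the signed area, positive for a
  counterclockwise triangle\<close>

definition orient :: "real^2 \<Rightarrow> real^2 \<Rightarrow> real^2 \<Rightarrow> real" where
  "orient a b c = (b$1 - a$1) * (c$2 - a$2) - (b$2 - a$2) * (c$1 - a$1)"

lemma orient_rotate: "orient a b c = orient b c a"
  by (simp add: orient_def algebra_simps)

lemma orient_swap: "orient a b c = - orient b a c"
  by (simp add: orient_def algebra_simps)

lemma orient_eq_0_if_between:
  assumes "b \<in> closed_segment a c"
  shows "orient a b c = 0"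
proof -
  obtain v where v: "b = (1 - v) *\<^sub>R a + v *\<^sub>R c" using assms by (auto simp: in_segment)
  show ?thesis unfolding v by (simp add: orient_def algebra_simps)
qed

lemma triangle_iff_orient: "triangle a b c \<longleftrightarrow> orient a b c \<noteq> 0"
proof
  assume tri: "triangle a b c"
  show "orient a b c \<noteq> 0"
  proof
    assume 0: "orient a b c = 0"
    \<comment> \<open>For either \<open>i\<close>, two of the three coordinates of this sum cancel
      identically, and the remaining one is \<open>orient a b c\<close> up to sign.\<close>
    have "(b$i - c$i) *\<^sub>R lift a + (c$i - a$i) *\<^sub>R lift b + (a$i - b$i) *\<^sub>R lift c = 0" for i
    proof -
      have "i = 1 \<or> i = 2" by (rule exhaust_2)
      then show ?thesis
        using 0 unfolding vec_eq_iff forall_3 orient_def by (elim disjE) (simp_all add: algebra_simps)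
    qed
    from triangle_independent(3)[OF tri this] have "a = b" by (simp add: vec_eq_iff)
    with tri show False by (simp add: triangle_def)
  qed
next
  assume *: "orient a b c \<noteq> 0"
  have "orient b a c \<noteq> 0" "orient a c b \<noteq> 0"
    using * by (simp_all add: orient_def algebra_simps)
  with * show "triangle a b c"
    unfolding triangle_def using orient_eq_0_if_between by metis
qed

text \<open>\<open>orient a b\<close> is affine and changes at a nonzero rate along the normal
  \<open>n\<close> of the line through \<open>a\<close> and \<open>b\<close>. Hence it cannot vanish
  both at an interior point \<open>p\<close> and at a point of \<open>K\<close> displaced from
  \<open>p\<close> along \<open>n\<close>.\<close>

lemma exists_triangle_point:
  assumes "interior K \<noteq> {}" "a \<noteq> b"
  obtains u where "u \<in> K" "triangle u a b"
proof -
  define D where "D = orient a b"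
  have tri: "triangle r a b" if "D r \<noteq> 0" for r
    using that orient_rotate[of r a b] by (simp add: D_def triangle_iff_orient)
  obtain p where "p \<in> interior K" using assms(1) by blast
  then obtain \<epsilon> where eps: "\<epsilon> > 0" "cball p \<epsilon> \<subseteq> K" using mem_interior_cball by blast
  define n :: "real^2" where "n = vector [a$2 - b$2, b$1 - a$1]"
  \<comment> \<open>Small enough for the displacement \<open>c *\<^sub>R n\<close> to stay in the
    ball of radius \<epsilon>.\<close>
  define c where "c = \<epsilon> / (norm n + 1)"
  have c0: "c > 0" unfolding c_def using eps by (simp add: add_nonneg_pos)
  have "c * norm n \<le> c * (norm n + 1)" using c0 by simp
  also have "\<dots> = \<epsilon>" unfolding c_def by (simp add: add_nonneg_eq_0_iff)
  finally have "c * norm n \<le> \<epsilon>" .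
  then have q: "p + c *\<^sub>R n \<in> cball p \<epsilon>" using c0 by (simp add: dist_norm)
  have "D (p + c *\<^sub>R n) - D p = c * ((b$1 - a$1)^2 + (b$2 - a$2)^2)"
    by (simp add: D_def orient_def n_def power2_eq_square algebra_simps)
  moreover have "(b$1 - a$1)^2 + (b$2 - a$2)^2 \<noteq> 0"
    using assms(2) by (auto simp: vec_eq_iff forall_2 sum_power2_eq_zero_iff)
  ultimately have "D (p + c *\<^sub>R n) \<noteq> 0 \<or> D p \<noteq> 0" using c0 by auto
  moreover have "p \<in> K" "p + c *\<^sub>R n \<in> K" using q eps by auto
  ultimately show ?thesis using that tri by blast
qed

text \<open>A finite coordinate never reaches \<open>b\<close>, so the moved vertex stays off
  \<open>b\<close> while remaining on the side through \<open>a\<close> and \<open>b\<close>.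
  Expanding in the independent lifts of \<open>u\<close>, \<open>a\<close>, \<open>b\<close> shows
  that no relation among the new vertices involves \<open>u\<close>.\<close>

lemma triangle_pt:
  assumes "triangle u a b" "x \<ge> 0"
  shows "triangle u (pt a b x) b"
proof -
  have x: "1 + x \<noteq> 0" using assms(2) by simp
  have no: "\<alpha> = 0" if "\<alpha> *\<^sub>R lift u + \<beta> *\<^sub>R lift (pt a b x) + \<gamma> *\<^sub>R lift b = 0" for \<alpha> \<beta> \<gamma>
  proof -
    have "(1 + x) *\<^sub>R (\<alpha> *\<^sub>R lift u + \<beta> *\<^sub>R lift (pt a b x) + \<gamma> *\<^sub>R lift b) =
      ((1 + x) * \<alpha>) *\<^sub>R lift u + \<beta> *\<^sub>R ((1 + x) *\<^sub>R lift (pt a b x)) + ((1 + x) * \<gamma>) *\<^sub>R lift b"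
      by (simp only: scaleR_right_distrib scaleR_scaleR mult.commute)
    also have "\<dots> = ((1 + x) * \<alpha>) *\<^sub>R lift u + \<beta> *\<^sub>R lift a + (\<beta> * x + (1 + x) * \<gamma>) *\<^sub>R lift b"
      unfolding lift_pt[OF assms(2)] by (simp add: algebra_simps)
    finally have "((1 + x) * \<alpha>) *\<^sub>R lift u + \<beta> *\<^sub>R lift a + (\<beta> * x + (1 + x) * \<gamma>) *\<^sub>R lift b = 0"
      using that by simp
    from triangle_independent(1)[OF assms(1) this] show ?thesis using x by simp
  qed
  have ne: "pt a b x \<noteq> b"
  proof
    assume "pt a b x = b"
    then have e: "1 *\<^sub>R lift a + (x - (1 + x)) *\<^sub>R lift b = 0 *\<^sub>R lift a + 0 *\<^sub>R lift b"
      using lift_pt[OF assms(2), of a b] by (simp add: algebra_simps)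
    have "a \<noteq> b" using assms(1) by (auto simp: triangle_def)
    from lift_indep2[OF this e] show False by simp
  qed
  show ?thesis unfolding triangle_def
  proof (intro conjI notI)
    assume "u \<in> closed_segment (pt a b x) b"
    then obtain \<alpha> \<beta> where "lift u = \<alpha> *\<^sub>R lift (pt a b x) + \<beta> *\<^sub>R lift b"
      unfolding closed_segment_lift by blast
    then have "1 *\<^sub>R lift u + (- \<alpha>) *\<^sub>R lift (pt a b x) + (- \<beta>) *\<^sub>R lift b = 0" by simp
    from no[OF this] show False by simp
  next
    assume "pt a b x \<in> closed_segment u b"
    then obtain \<alpha> \<beta> where e: "lift (pt a b x) = \<alpha> *\<^sub>R lift u + \<beta> *\<^sub>R lift b"
      unfolding closed_segment_lift by blast
    then have "\<alpha> *\<^sub>R lift u + (- 1) *\<^sub>R lift (pt a b x) + \<beta> *\<^sub>R lift b = 0" by simp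
    from no[OF this] e have "1 *\<^sub>R lift (pt a b x) = \<beta> *\<^sub>R lift b" by simp
    from lift_scaleR_eq[OF this] ne show False by simp
  next
    assume "b \<in> closed_segment u (pt a b x)"
    then obtain \<alpha> \<beta> where e: "lift b = \<alpha> *\<^sub>R lift u + \<beta> *\<^sub>R lift (pt a b x)"
      unfolding closed_segment_lift by blast
    then have "\<alpha> *\<^sub>R lift u + \<beta> *\<^sub>R lift (pt a b x) + (- 1) *\<^sub>R lift b = 0" by simp
    from no[OF this] e have "\<beta> *\<^sub>R lift (pt a b x) = 1 *\<^sub>R lift b" by simp
    from lift_scaleR_eq[OF this] ne show False by simp
  qed
qed

text \<open>The points \<open>y\<close>, \<open>g\<close> and \<open>h\<close> of the figure are proportional to \<open>x + d b\<close>, \<open>x + d b + k u\<close>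
  and \<open>2 x + d b + k u\<close>.\<close>

lemma mid_figure_unique:
  assumes tri: "triangle u x b" and d: "d > 0" and y: "c *\<^sub>R lift y = lift x + d *\<^sub>R lift b" "c > 0"
    and f: "f \<noteq> u" "f \<noteq> x" "f \<in> closed_segment u x"
    and g: "g \<in> closed_segment f b" "g \<in> closed_segment u y"
    and h: "h \<in> closed_segment x g" "h \<in> closed_segment y f" "h \<in> closed_segment u z"
    and z: "z \<in> closed_segment x y"
  obtains \<epsilon> where "lift z = \<epsilon> *\<^sub>R (lift x + c *\<^sub>R lift y)"
proof -
  note unique = triangle_coords_unique[OF tri]
  have y': "lift y = (1 / c) *\<^sub>R lift x + (d / c) *\<^sub>R lift b"
  proof -
    have "(1 / c) *\<^sub>R (c *\<^sub>R lift y) = (1 / c) *\<^sub>R lift x + (d / c) *\<^sub>R lift b"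
      unfolding y(1) by (simp add: scaleR_right_distrib)
    then show ?thesis using y(2) by simp
  qed
  obtain k l where kl: "k \<ge> 0" "l \<ge> 0" "lift f = k *\<^sub>R lift u + l *\<^sub>R lift x"
    using f(3) unfolding closed_segment_lift by blast
  have "k \<noteq> 0"
  proof
    assume "k = 0"
    then have "1 *\<^sub>R lift f = l *\<^sub>R lift x" using kl by simp
    from lift_scaleR_eq[OF this] f show False by simp
  qed
  have "l \<noteq> 0"
  proof
    assume "l = 0"
    then have "1 *\<^sub>R lift f = k *\<^sub>R lift u" using kl by simp
    from lift_scaleR_eq[OF this] f show False by simp
  qed
  obtain \<alpha>1 \<alpha>2 where g1: "lift g = \<alpha>1 *\<^sub>R lift f + \<alpha>2 *\<^sub>R lift b"
    using g(1) unfolding closed_segment_lift by blast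
  obtain \<alpha>3 \<alpha>4 where g2: "lift g = \<alpha>3 *\<^sub>R lift u + \<alpha>4 *\<^sub>R lift y"
    using g(2) unfolding closed_segment_lift by blast
  have "(\<alpha>1 * k) *\<^sub>R lift u + (\<alpha>1 * l) *\<^sub>R lift x + \<alpha>2 *\<^sub>R lift b =
    \<alpha>3 *\<^sub>R lift u + (\<alpha>4 / c) *\<^sub>R lift x + (\<alpha>4 * d / c) *\<^sub>R lift b"
    using g1 g2 unfolding kl(3) y' by (simp add: scaleR_right_distrib add.assoc)
  from unique[OF this] have "\<alpha>1 * l = \<alpha>4 / c" "\<alpha>2 = \<alpha>4 * d / c" by auto
  then have \<alpha>: "\<alpha>2 = \<alpha>1 * l * d" by simp
  have g3: "lift g = \<alpha>1 *\<^sub>R (k *\<^sub>R lift u + l *\<^sub>R lift x + (l * d) *\<^sub>R lift b)"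
    unfolding g1 kl(3) \<alpha> by (simp add: scaleR_right_distrib)
  have "\<alpha>1 \<noteq> 0" using g3 lift_nonzero[of g] by auto
  obtain \<beta>1 \<beta>2 where h1: "lift h = \<beta>1 *\<^sub>R lift x + \<beta>2 *\<^sub>R lift g"
    using h(1) unfolding closed_segment_lift by blast
  obtain \<beta>3 \<beta>4 where h2: "lift h = \<beta>3 *\<^sub>R lift y + \<beta>4 *\<^sub>R lift f"
    using h(2) unfolding closed_segment_lift by blast
  obtain \<beta>5 \<beta>6 where h3: "lift h = \<beta>5 *\<^sub>R lift u + \<beta>6 *\<^sub>R lift z"
    using h(3) unfolding closed_segment_lift by blast
  obtain \<gamma>1 \<gamma>2 where z1: "lift z = \<gamma>1 *\<^sub>R lift x + \<gamma>2 *\<^sub>R lift y"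
    using z unfolding closed_segment_lift by blast
  define \<mu> where "\<mu> = \<beta>2 * \<alpha>1"
  have h4: "lift h = (\<mu> * k) *\<^sub>R lift u + (\<beta>1 + \<mu> * l) *\<^sub>R lift x + (\<mu> * l * d) *\<^sub>R lift b"
    unfolding h1 g3 \<mu>_def by (simp add: algebra_simps)
  have h5: "lift h = (\<beta>4 * k) *\<^sub>R lift u + (\<beta>4 * l + \<beta>3 / c) *\<^sub>R lift x + (\<beta>3 * d / c) *\<^sub>R lift b"
    unfolding h2 kl(3) y' by (simp add: algebra_simps)
  have h6: "lift h = \<beta>5 *\<^sub>R lift u + (\<beta>6 * \<gamma>1 + \<beta>6 * \<gamma>2 / c) *\<^sub>R lift x + (\<beta>6 * \<gamma>2 * d / c) *\<^sub>R lift b"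
    unfolding h3 z1 y' by (simp add: algebra_simps)
  \<comment> \<open>\<open>h\<close> is on both diagonals. Its coordinates along \<open>u\<close>
    and \<open>b\<close> fix the scales \<open>\<beta>4\<close> and \<open>\<beta>3\<close>; the
    coordinate along \<open>x\<close> then gives \<open>\<beta>1 = \<mu> * l\<close>, the source of
    the factor 2 in front of \<open>x\<close>.\<close>
  have E1: "\<mu> * k = \<beta>4 * k" "\<beta>1 + \<mu> * l = \<beta>4 * l + \<beta>3 / c" "\<mu> * l * d = \<beta>3 * d / c"
    using unique[OF h4[unfolded h5]] by auto
  have E2: "\<beta>6 * \<gamma>1 + \<beta>6 * \<gamma>2 / c = \<beta>1 + \<mu> * l" "\<beta>6 * \<gamma>2 * d / c = \<mu> * l * d"
    using unique[OF h4[unfolded h6]] by auto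
  have "(\<beta>3 / c) * d = (\<mu> * l) * d" using E1(3) by simp
  then have m: "\<beta>4 = \<mu>" "\<beta>3 / c = \<mu> * l"
    using E1(1) \<open>k \<noteq> 0\<close> d unfolding mult_cancel_right by auto
  have b1: "\<beta>1 = \<mu> * l" using E1(2) m by simp
  have "\<mu> \<noteq> 0"
  proof
    assume "\<mu> = 0"
    then have "lift h = 0" using h4 b1 by simp
    then show False by simp
  qed
  \<comment> \<open>Projection from \<open>u\<close> forgets the coordinate along \<open>u\<close>;
    those along \<open>x\<close> and \<open>b\<close> agree for \<open>h\<close> and
    \<open>z\<close> up to the factor \<open>\<beta>6\<close>.\<close>
  have "(\<beta>6 * (\<gamma>2 / c)) * d = (\<mu> * l) * d" using E2(2) by simp
  then have e1: "\<beta>6 * (\<gamma>2 / c) = \<mu> * l" using d unfolding mult_cancel_right by auto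
  have e2: "\<beta>6 * \<gamma>1 = \<mu> * l" using E2(1) e1 unfolding b1 times_divide_eq_right by linarith
  have "\<beta>6 \<noteq> 0" using e1 \<open>\<mu> \<noteq> 0\<close> \<open>l \<noteq> 0\<close> by auto
  then have "\<gamma>2 / c = \<gamma>1" using e1 e2 by (metis mult_cancel_left)
  then have "\<gamma>2 = \<gamma>1 * c" using y(2) by (auto simp: field_simps)
  then have "lift z = \<gamma>1 *\<^sub>R (lift x + c *\<^sub>R lift y)" unfolding z1 by (simp add: scaleR_right_distrib)
  then show ?thesis using that by blast
qed

text \<open>The free choice in the figure is the position of \<open>f\<close> on the side
  \<open>u x\<close>. Its midpoint is chosen, so \<open>f\<close>, \<open>g\<close>,
  \<open>h\<close> are the normalised sums \<open>u + x\<close>, \<open>u + x + d b\<close>,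
  \<open>u + 2 x + d b\<close> of lifts, and each incidence is visible as a nonnegative
  combination.\<close>

lemma mid_figure_exists:
  assumes K: "convex K" and uK: "u \<in> K" "x \<in> K" "b \<in> K" "y \<in> K"
    and tri: "triangle u x b" and d: "d > 0" and y: "c *\<^sub>R lift y = lift x + d *\<^sub>R lift b" "c > 0"
    and z: "\<epsilon> *\<^sub>R lift z = lift x + c *\<^sub>R lift y" "\<epsilon> > 0"
  shows "mid_figure K x y b z"
proof -
  have ux: "u \<noteq> x" using tri by (auto simp: triangle_def)
  have c: "c = 1 + d" using arg_cong[OF y(1), of "\<lambda>v. v $ 3"] by simp
  have sub: "p \<in> K" if "p \<in> closed_segment q r" "q \<in> K" "r \<in> K" for p q r
    using K that by (meson closed_segment_subset subsetD)
  obtain f where f: "lift f = (1 / 2) *\<^sub>R (lift u + lift x)"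
    using lift_exists[of "lift u + lift x"] by auto
  obtain g where g: "lift g = (1 / (2 + d)) *\<^sub>R (lift u + lift x + d *\<^sub>R lift b)"
    using lift_exists[of "lift u + lift x + d *\<^sub>R lift b"] d by auto
  obtain h where h: "lift h = (1 / (3 + d)) *\<^sub>R (lift u + lift x + (lift x + d *\<^sub>R lift b))"
    using lift_exists[of "lift u + lift x + (lift x + d *\<^sub>R lift b)"] d by auto
  have f': "2 *\<^sub>R lift f = lift u + lift x" unfolding f by simp
  have g': "(2 + d) *\<^sub>R lift g = lift u + lift x + d *\<^sub>R lift b" unfolding g using d by simp
  have h': "(3 + d) *\<^sub>R lift h = lift u + lift x + (lift x + d *\<^sub>R lift b)" unfolding h using d by simp
  have fs: "f \<in> closed_segment u x"
    by (rule closed_segment_liftI[of 2 _ 1 _ 1]) (simp_all add: f')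
  have gs: "g \<in> closed_segment f b"
    by (rule closed_segment_liftI[of "2 + d" _ 2 _ d]) (use d in \<open>simp_all add: f' g'\<close>)
  have gs2: "g \<in> closed_segment u y"
    by (rule closed_segment_liftI[of "2 + d" _ 1 _ c]) (use d y in \<open>simp_all add: g'\<close>)
  have hs: "h \<in> closed_segment x g"
    by (rule closed_segment_liftI[of "3 + d" _ 1 _ "2 + d"]) (use d in \<open>simp_all add: g' h'\<close>)
  have hs2: "h \<in> closed_segment y f"
    by (rule closed_segment_liftI[of "3 + d" _ c _ 2]) (use d y in \<open>simp_all add: f' h'\<close>)
  have hs3: "h \<in> closed_segment u z"
    by (rule closed_segment_liftI[of "3 + d" _ 1 _ \<epsilon>]) (use d y z in \<open>simp_all add: h'\<close>)
  have zs: "z \<in> closed_segment x y"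
    by (rule closed_segment_liftI[of \<epsilon> _ 1 _ c]) (use y z in simp_all)
  have "f \<noteq> u"
  proof
    assume "f = u"
    then have "1 *\<^sub>R lift u = 1 *\<^sub>R lift x" using f' by (simp add: scaleR_2)
    from lift_scaleR_eq[OF this] ux show False by simp
  qed
  moreover have "f \<noteq> x"
  proof
    assume "f = x"
    then have "1 *\<^sub>R lift u = 1 *\<^sub>R lift x" using f' by (simp add: scaleR_2)
    from lift_scaleR_eq[OF this] ux show False by simp
  qed
  moreover have "f \<in> K" using sub fs uK by blast
  moreover have "g \<in> K" using sub gs2 uK by blast
  moreover have "h \<in> K" using sub hs calculation uK by blast
  ultimately show ?thesis unfolding mid_figure_def
    using uK(1) tri fs gs gs2 hs hs2 hs3 zs by blast
qed

text \<open>With \<open>b\<close> at infinity, the harmonic conjugate of \<open>b\<close> is the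
  arithmetic mean of the two coordinates, whatever auxiliary points the figure uses. The interior of
  \<open>K\<close> supplies an apex \<open>u\<close> off the line.\<close>

lemma mid_figure_iff:
  assumes K: "convex K" "interior K \<noteq> {}" and ab: "a \<in> K" "b \<in> K" "a \<noteq> b" and xy: "0 \<le> x" "x < y"
  shows "mid_figure K (pt a b x) (pt a b y) b z \<longleftrightarrow> z = pt a b ((x + y) / 2)"
proof -
  \<comment> \<open>Coordinates based at \<open>pt a b x\<close> instead of \<open>a\<close>: there
    \<open>pt a b y\<close> has coordinate \<open>d\<close>, and \<open>c = 1 + d\<close> is its
    normalising factor.\<close>
  define d c where "d = (y - x) / (1 + x)" and "c = (1 + y) / (1 + x)"
  have pos: "d > 0" "c > 0" using xy by (auto simp: d_def c_def)
  have y0: "y \<ge> 0" using xy by simp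
  have c1: "(1 + x) * c = 1 + y" "(1 + x) * d = y - x" unfolding c_def d_def using xy by simp_all
  have Y: "c *\<^sub>R lift (pt a b y) = lift (pt a b x) + d *\<^sub>R lift b"
  proof -
    have "(1 + x) *\<^sub>R (c *\<^sub>R lift (pt a b y)) = (1 + y) *\<^sub>R lift (pt a b y)"
      by (simp add: c1)
    also have "\<dots> = lift a + y *\<^sub>R lift b" by (rule lift_pt[OF y0])
    also have "\<dots> = (lift a + x *\<^sub>R lift b) + (y - x) *\<^sub>R lift b" by (simp add: algebra_simps)
    also have "\<dots> = (1 + x) *\<^sub>R lift (pt a b x) + ((1 + x) * d) *\<^sub>R lift b"
      unfolding lift_pt[OF xy(1)] c1 ..
    also have "\<dots> = (1 + x) *\<^sub>R (lift (pt a b x) + d *\<^sub>R lift b)"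
      by (simp only: scaleR_right_distrib scaleR_scaleR)
    finally show ?thesis using xy by (simp only: scaleR_cancel_left) auto
  qed
  have S: "lift (pt a b x) + c *\<^sub>R lift (pt a b y) =
      (2 / (1 + x)) *\<^sub>R (lift a + ((x + y) / 2) *\<^sub>R lift b)"
  proof -
    have "(1 + x) *\<^sub>R (lift (pt a b x) + c *\<^sub>R lift (pt a b y)) =
      (1 + x) *\<^sub>R lift (pt a b x) + ((1 + x) * c) *\<^sub>R lift (pt a b y)"
      by (simp only: scaleR_right_distrib scaleR_scaleR)
    also have "\<dots> = (lift a + x *\<^sub>R lift b) + (lift a + y *\<^sub>R lift b)"
      unfolding c1 lift_pt[OF y0] lift_pt[OF xy(1)] ..
    also have "\<dots> = 2 *\<^sub>R (lift a + ((x + y) / 2) *\<^sub>R lift b)"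
      by (simp add: scaleR_right_distrib scaleR_2 flip: scaleR_left_distrib)
    also have "\<dots> = (1 + x) *\<^sub>R ((2 / (1 + x)) *\<^sub>R (lift a + ((x + y) / 2) *\<^sub>R lift b))"
    proof -
      have "1 + x \<noteq> 0" using xy by simp
      then have "(1 + x) * (2 / (1 + x)) = 2" by (metis nonzero_mult_div_cancel_left times_divide_eq_right)
      then show ?thesis by (simp only: scaleR_scaleR)
    qed
    finally show ?thesis using xy by (simp only: scaleR_cancel_left) auto
  qed
  have inK: "pt a b s \<in> K" if "s \<ge> 0" for s
    using pt_in_segment[OF that] K(1) ab by (meson closed_segment_subset subsetD)
  show ?thesis
  proof
    assume "mid_figure K (pt a b x) (pt a b y) b z"
    then obtain u f g h where
      "triangle u (pt a b x) b" "f \<noteq> u" "f \<noteq> pt a b x"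
      "f \<in> closed_segment u (pt a b x)" "g \<in> closed_segment f b" "g \<in> closed_segment u (pt a b y)"
      "h \<in> closed_segment (pt a b x) g" "h \<in> closed_segment (pt a b y) f"
      "h \<in> closed_segment u z" "z \<in> closed_segment (pt a b x) (pt a b y)"
      unfolding mid_figure_def by blast
    from mid_figure_unique[OF this(1) pos(1) Y pos(2) this(2-10)]
    obtain \<epsilon> where "lift z = \<epsilon> *\<^sub>R (lift (pt a b x) + c *\<^sub>R lift (pt a b y))" by blast
    then have "1 *\<^sub>R lift z = (\<epsilon> * (2 / (1 + x))) *\<^sub>R (lift a + ((x + y) / 2) *\<^sub>R lift b)"
      unfolding S by simp
    then show "z = pt a b ((x + y) / 2)" by (rule pt_eqI) (use xy in auto)
  next
    assume z: "z = pt a b ((x + y) / 2)"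
    obtain u where u: "u \<in> K" "triangle u a b"
      using exists_triangle_point[OF K(2) ab(3)] by blast
    have Z: "(1 + c) *\<^sub>R lift z = lift (pt a b x) + c *\<^sub>R lift (pt a b y)"
    proof -
      have nn: "(x + y) / 2 \<ge> 0" using xy by simp
      have "1 + c = (2 / (1 + x)) * (1 + (x + y) / 2)" unfolding c_def using xy by (simp add: field_simps)
      then show ?thesis unfolding S z lift_pt[OF nn, symmetric] by simp
    qed
    show "mid_figure K (pt a b x) (pt a b y) b z"
      by (rule mid_figure_exists[OF K(1) u(1) inK[OF xy(1)] ab(2) inK[OF y0]
            triangle_pt[OF u(2) xy(1)] pos(1) Y pos(2) Z])
        (use pos in simp)
  qed
qed

section \<open>The type determines cross ratios\<close>

lemma betweenness_struct_simps [simp]: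
  "fst (betweenness_struct K) = K"
  "snd (betweenness_struct K) a x b \<longleftrightarrow> x \<in> closed_segment a b"
  by (simp_all add: betweenness_struct_def)

text \<open>The variables \<open>k, \<dots>, k + 3\<close> serve as bound variables, so they should be fresh.\<close>

definition mid_fm :: "nat \<Rightarrow> nat \<Rightarrow> nat \<Rightarrow> nat \<Rightarrow> nat \<Rightarrow> fm" where
  "mid_fm k x y b z = Ex k (Ex (k + 1) (Ex (k + 2) (Ex (k + 3)
     (Conj (Conj (Neg (Bet x k b)) (Conj (Neg (Bet k x b)) (Neg (Bet k b x))))
     (Conj (Neg (Eq (k + 1) k)) (Conj (Neg (Eq (k + 1) x))
     (Conj (Bet k (k + 1) x) (Conj (Bet (k + 1) (k + 2) b) (Conj (Bet k (k + 2) y)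
     (Conj (Bet x (k + 3) (k + 2)) (Conj (Bet y (k + 3) (k + 1))
     (Conj (Bet k (k + 3) z) (Bet x z y)))))))))))))"

lemma free_vars_mid_fm: "free_vars (mid_fm k x y b z) \<subseteq> {x, y, b, z}"
  by (auto simp: mid_fm_def)

lemma sat_mid_fm:
  assumes "x < k" "y < k" "b < k" "z < k"
  shows "sat (betweenness_struct K) e (mid_fm k x y b z) \<longleftrightarrow> mid_figure K (e x) (e y) (e b) (e z)"
proof -
  have ne: "x \<noteq> k" "x \<noteq> Suc k" "x \<noteq> k + 2" "x \<noteq> k + 3" "y \<noteq> k" "y \<noteq> Suc k" "y \<noteq> k + 2" "y \<noteq> k + 3"
    "b \<noteq> k" "b \<noteq> Suc k" "b \<noteq> k + 2" "b \<noteq> k + 3" "z \<noteq> k" "z \<noteq> Suc k" "z \<noteq> k + 2" "z \<noteq> k + 3"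
    using assms by auto
  show ?thesis
    unfolding mid_fm_def mid_figure_def triangle_def using ne by simp
qed

lemma same_type_between:
  assumes "same_type S (betweenness_struct K) e (betweenness_struct K') e'" "i \<in> S" "j \<in> S" "k \<in> S"
  shows "e j \<in> closed_segment (e i) (e k) \<longleftrightarrow> e' j \<in> closed_segment (e' i) (e' k)"
  using same_typeD[OF assms(1), of "Bet i j k"] assms(2-4) by simp

lemma same_type_eq:
  assumes "same_type S (betweenness_struct K) e (betweenness_struct K') e'" "i \<in> S" "j \<in> S"
  shows "e i = e j \<longleftrightarrow> e' i = e' j"
  using same_typeD[OF assms(1), of "Eq i j"] assms(2-3) by simp

text \<open>Bisecting the interval from \<open>x\<close> to \<open>y\<close> at its definable harmonic midpoint, both coordinates \<open>t\<close>
  and \<open>t'\<close> fall into the same half.\<close>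

lemma bisection:
  assumes K: "convex K" "interior K \<noteq> {}" "a \<in> K" "b \<in> K" "a \<noteq> b"
    and K': "convex K'" "interior K' \<noteq> {}" "a' \<in> K'" "b' \<in> K'" "a' \<noteq> b'"
    and ty: "same_type {..<n} (betweenness_struct K) e (betweenness_struct K') e'"
    and idx: "ix < n" "iy < n" "ib < n" "it < n"
    and e: "e ix = pt a b x" "e iy = pt a b y" "e ib = b" "e it = pt a b t"
    and e': "e' ix = pt a' b' x'" "e' iy = pt a' b' y'" "e' ib = b'" "e' it = pt a' b' t'"
    and t: "0 \<le> x" "x < y" "x \<le> t" "t \<le> y"
    and t': "0 \<le> x'" "x' < y'" "x' \<le> t'" "t' \<le> y'"
  shows "\<bar>(t - x) / (y - x) - (t' - x') / (y' - x')\<bar> \<le> (1 / 2) ^ m"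
  using ty idx e e' t t'
proof (induction m arbitrary: n e e' ix iy x y x' y')
  case 0
  have "0 \<le> (t - x) / (y - x)" "(t - x) / (y - x) \<le> 1"
    "0 \<le> (t' - x') / (y' - x')" "(t' - x') / (y' - x') \<le> 1"
    using 0 by (auto simp: field_simps)
  then show ?case by auto
next
  case (Suc m)
  note ty = Suc.prems(1) and idx = Suc.prems(2-5) and e = Suc.prems(6-9) and e' = Suc.prems(10-13)
    and t = Suc.prems(14-17) and t' = Suc.prems(18-21)
  \<comment> \<open>Variable \<open>n\<close> receives the midpoint, so bound variables start at
    \<open>Suc n\<close>. The formula has exactly one solution in each structure, which forces
    \<open>same_type_extend\<close> to return \<open>?z'\<close>.\<close>
  let ?\<psi> = "mid_fm (Suc n) ix iy ib n"
  let ?z = "pt a b ((x + y) / 2)" and ?z' = "pt a' b' ((x' + y') / 2)"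
  have sat: "sat (betweenness_struct K) (e(n := z)) ?\<psi> \<longleftrightarrow> z = ?z" for z
    using idx mid_figure_iff[OF K t(1,2)] e by (subst sat_mid_fm) auto
  have sat': "sat (betweenness_struct K') (e'(n := z)) ?\<psi> \<longleftrightarrow> z = ?z'" for z
    using idx mid_figure_iff[OF K' t'(1,2)] e' by (subst sat_mid_fm) auto
  have "?z \<in> closed_segment a b" by (rule pt_in_segment) (use t in simp)
  then have zK: "?z \<in> K" using K by (meson closed_segment_subset subsetD)
  have "free_vars ?\<psi> \<subseteq> insert n {..<n}" using free_vars_mid_fm[of "Suc n" ix iy ib n] idx by auto
  from same_type_extend[OF ty this, of ?z] zK
  have ty2: "same_type (insert n {..<n}) (betweenness_struct K) (e(n := ?z)) (betweenness_struct K') (e'(n := ?z'))"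
    unfolding sat sat' by (auto simp: Collect_conv_if)
  then have ty2: "same_type {..<Suc n} (betweenness_struct K) (e(n := ?z)) (betweenness_struct K') (e'(n := ?z'))"
    by (simp add: lessThan_Suc)
  have half: "t \<le> (x + y) / 2 \<longleftrightarrow> t' \<le> (x' + y') / 2"
  proof -
    have "t \<le> (x + y) / 2 \<longleftrightarrow> pt a b t \<in> closed_segment (pt a b x) ?z"
      using t K by (subst pt_between_iff) auto
    also have "\<dots> \<longleftrightarrow> pt a' b' t' \<in> closed_segment (pt a' b' x') ?z'"
      using same_type_between[OF ty2, of ix it n] idx e e' by simp
    also have "\<dots> \<longleftrightarrow> t' \<le> (x' + y') / 2"
      using t' K' by (subst pt_between_iff) auto
    finally show ?thesis .
  qed
  have idx': "ix < Suc n" "iy < Suc n" "ib < Suc n" "it < Suc n" "n < Suc n" using idx by auto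
  \<comment> \<open>Restricting to a half changes the relative position \<open>p\<close> in the
    interval to \<open>2 * p\<close> on the left and \<open>2 * p - 1\<close> on the right, so the
    error bound for the half is halved for the whole.\<close>
  have scale1: "\<bar>p - q\<bar> \<le> (1 / 2) ^ Suc m" if "\<bar>(2 * p - 1) - (2 * q - 1)\<bar> \<le> (1 / 2) ^ m" for p q :: real
    using that unfolding power_Suc by linarith
  have scale: "\<bar>p - q\<bar> \<le> (1 / 2) ^ Suc m" if "\<bar>2 * p - 2 * q\<bar> \<le> (1 / 2) ^ m" for p q :: real
    using that unfolding power_Suc by linarith
  show ?case
  proof (cases "t \<le> (x + y) / 2")
    case True
    have "\<bar>(t - x) / ((x + y) / 2 - x) - (t' - x') / ((x' + y') / 2 - x')\<bar> \<le> (1 / 2) ^ m"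
      by (rule Suc.IH[OF ty2 idx'(1) idx'(5) idx'(3,4)])
        (use e e' idx t t' True half in simp_all)
    moreover have "(t - x) / ((x + y) / 2 - x) = 2 * ((t - x) / (y - x))"
      using t by (simp add: field_simps)
    moreover have "(t' - x') / ((x' + y') / 2 - x') = 2 * ((t' - x') / (y' - x'))"
      using t' by (simp add: field_simps)
    ultimately show ?thesis by (intro scale) (simp only:)
  next
    case False
    have "\<bar>(t - (x + y) / 2) / (y - (x + y) / 2) - (t' - (x' + y') / 2) / (y' - (x' + y') / 2)\<bar> \<le> (1 / 2) ^ m"
      by (rule Suc.IH[OF ty2 idx'(5) idx'(2) idx'(3,4)])
        (use e e' idx t t' False half in simp_all)
    moreover have "(t - (x + y) / 2) / (y - (x + y) / 2) = 2 * ((t - x) / (y - x)) - 1"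
      using t by (simp add: field_simps)
    moreover have "(t' - (x' + y') / 2) / (y' - (x' + y') / 2) = 2 * ((t' - x') / (y' - x')) - 1"
      using t' by (simp add: field_simps)
    ultimately show ?thesis by (intro scale1) (simp only:)
  qed
qed

text \<open>Bisection of the interval from 0 to \<open>y\<close> keeps the relative positions of
  \<open>t\<close> and \<open>t'\<close> within \<open>(1 / 2) ^ m\<close> for every
  \<open>m\<close>. That \<open>t'\<close> lies in its interval as well is read off the type, as
  \<open>t \<le> y\<close> is a betweenness statement.\<close>

lemma ratio_le_one:
  assumes K: "convex K" "interior K \<noteq> {}" "a \<in> K" "b \<in> K" "a \<noteq> b"
    and K': "convex K'" "interior K' \<noteq> {}" "a' \<in> K'" "b' \<in> K'" "a' \<noteq> b'"
    and ty: "same_type {..<n} (betweenness_struct K) e (betweenness_struct K') e'"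
    and idx: "ia < n" "ib < n" "iy < n" "it < n"
    and e: "e ia = a" "e ib = b" "e iy = pt a b y" "e it = pt a b t"
    and e': "e' ia = a'" "e' ib = b'" "e' iy = pt a' b' y'" "e' it = pt a' b' t'"
    and t: "0 < y" "0 < t" "t \<le> y" and t': "0 < y'" "0 < t'"
  shows "t / y = t' / y'"
proof -
  have "pt a b t \<in> closed_segment a (pt a b y)"
    using pt_between_iff[of a b 0 y t] K t by simp
  then have "pt a' b' t' \<in> closed_segment a' (pt a' b' y')"
    using same_type_between[OF ty, of ia it iy] idx e e' by simp
  then have t'y: "t' \<le> y'" using pt_between_iff[of a' b' 0 y' t'] K' t' by simp
  have "\<bar>(t - 0) / (y - 0) - (t' - 0) / (y' - 0)\<bar> \<le> (1 / 2) ^ m" for m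
    by (rule bisection[OF K K' ty idx(1,3,2,4)]) (use e e' t t' t'y in simp_all)
  then have bound: "\<bar>t / y - t' / y'\<bar> \<le> (1 / 2) ^ m" for m by simp
  have "(\<lambda>m. (1 / 2 :: real) ^ m) \<longlonglongrightarrow> 0" by (rule LIMSEQ_power_zero) simp
  then have "\<bar>t / y - t' / y'\<bar> \<le> 0" using bound by (intro LIMSEQ_le_const) auto
  then show ?thesis by simp
qed

text \<open>If \<open>t\<close> is beyond \<open>y\<close>, exchanging \<open>a\<close> and
  \<open>b\<close> inverts all coordinates and reverses their order, which reduces to the previous
  case.\<close>

lemma ratio_eq:
  assumes K: "convex K" "interior K \<noteq> {}" "a \<in> K" "b \<in> K" "a \<noteq> b"
    and K': "convex K'" "interior K' \<noteq> {}" "a' \<in> K'" "b' \<in> K'" "a' \<noteq> b'"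
    and ty: "same_type {..<n} (betweenness_struct K) e (betweenness_struct K') e'"
    and idx: "ia < n" "ib < n" "iy < n" "it < n"
    and e: "e ia = a" "e ib = b" "e iy = pt a b y" "e it = pt a b t"
    and e': "e' ia = a'" "e' ib = b'" "e' iy = pt a' b' y'" "e' it = pt a' b' t'"
    and t: "0 < y" "0 < t" and t': "0 < y'" "0 < t'"
  shows "t / y = t' / y'"
proof (cases "t \<le> y")
  case True
  show ?thesis by (rule ratio_le_one[OF K K' ty idx e e' t True t'])
next
  case False
  have sw: "e iy = pt b a (1 / y)" "e it = pt b a (1 / t)"
    "e' iy = pt b' a' (1 / y')" "e' it = pt b' a' (1 / t')"
    using e(3,4) e'(3,4) t t' pt_swap[of y a b] pt_swap[of t a b] pt_swap[of y' a' b'] pt_swap[of t' a' b'] by auto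
  have "(1 / t) / (1 / y) = (1 / t') / (1 / y')"
    by (rule ratio_le_one[OF K(1,2,4,3) K(5)[symmetric] K'(1,2,4,3) K'(5)[symmetric] ty idx(2,1,3,4)
          e(2,1) sw(1,2) e'(2,1) sw(3,4)])
      (use t t' False in \<open>simp_all add: divide_simps\<close>)
  then show ?thesis using t t' by (simp add: field_simps)
qed

section \<open>Vertices\<close>

definition extreme_fm :: "nat \<Rightarrow> nat \<Rightarrow> fm" where
  "extreme_fm k i = Neg (Ex k (Ex (k + 1)
    (Conj (Bet k i (k + 1)) (Conj (Neg (Eq k i)) (Neg (Eq (k + 1) i))))))"

lemma sat_extreme_fm:
  assumes "i < k" "e i \<in> K"
  shows "sat (betweenness_struct K) e (extreme_fm k i) \<longleftrightarrow> e i extreme_point_of K"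
proof -
  have "i \<noteq> k" "i \<noteq> Suc k" using assms by auto
  then show ?thesis using assms(2)
    by (auto simp: extreme_fm_def extreme_point_of_def open_segment_def)
qed

text \<open>Being a vertex is expressible by \<open>extreme_fm\<close>, and \<open>Q\<close> has
  finitely many vertices, so this is an instance of an algebraic extension.\<close>

lemma same_type_extend_vertex:
  assumes ty: "same_type {..<n} (betweenness_struct P) v (betweenness_struct Q) w"
    and x: "x extreme_point_of P" and fin: "finite {y. y extreme_point_of Q}"
  obtains y where "y extreme_point_of Q"
    "same_type {..<Suc n} (betweenness_struct P) (v(n := x)) (betweenness_struct Q) (w(n := y))"
proof -
  let ?\<psi> = "extreme_fm (Suc n) n"
  have fv: "free_vars ?\<psi> \<subseteq> insert n {..<n}" by (auto simp: extreme_fm_def)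
  have sat: "sat (betweenness_struct K) (e(n := z)) ?\<psi> \<longleftrightarrow> z extreme_point_of K" if "z \<in> K" for K e z
    using sat_extreme_fm[of n "Suc n" "e(n := z)" K] that by simp
  have xP: "x \<in> P" using x by (simp add: extreme_point_of_def)
  have "{y \<in> Q. sat (betweenness_struct Q) (w(n := y)) ?\<psi>} \<subseteq> {y. y extreme_point_of Q}"
    using sat by blast
  then have "finite {y \<in> Q. sat (betweenness_struct Q) (w(n := y)) ?\<psi>}"
    using fin finite_subset by blast
  then have "\<exists>y\<in>fst (betweenness_struct Q). sat (betweenness_struct Q) (w(n := y)) ?\<psi> \<and>
    same_type (insert n {..<n}) (betweenness_struct P) (v(n := x)) (betweenness_struct Q) (w(n := y))"
    by (intro same_type_extend[OF ty fv])
      (simp_all only: betweenness_struct_simps xP sat[OF xP] x)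
  then obtain y where y: "y \<in> Q" "sat (betweenness_struct Q) (w(n := y)) ?\<psi>"
    and ty': "same_type (insert n {..<n}) (betweenness_struct P) (v(n := x)) (betweenness_struct Q) (w(n := y))"
    unfolding betweenness_struct_simps by blast
  show ?thesis
    by (rule that[of y]) (use sat[OF y(1)] y(2) ty' in \<open>simp_all only: lessThan_Suc\<close>)
qed

lemma same_type_vertices:
  assumes "elementarily_equivalent (betweenness_struct P) (betweenness_struct Q)" "P \<noteq> {}" "Q \<noteq> {}"
    and fin: "finite {y. y extreme_point_of Q}"
    and "\<And>i. i < n \<Longrightarrow> v i extreme_point_of P"
  shows "\<exists>w. same_type {..<n} (betweenness_struct P) v (betweenness_struct Q) w \<and>
    (\<forall>i<n. w i extreme_point_of Q)"
  using assms(5)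
proof (induction n)
  case 0
  then show ?case using same_type_empty[OF assms(1)] assms(2,3) by auto
next
  case (Suc n)
  then obtain w where w: "same_type {..<n} (betweenness_struct P) v (betweenness_struct Q) w"
    "\<forall>i<n. w i extreme_point_of Q" by auto
  from same_type_extend_vertex[OF w(1) Suc.prems fin, of n]
  obtain y where "y extreme_point_of Q"
    "same_type {..<Suc n} (betweenness_struct P) (v(n := v n)) (betweenness_struct Q) (w(n := y))"
    by blast
  with w(2) show ?case by (intro exI[of _ "w(n := y)"]) (auto simp: less_Suc_eq fun_upd_triv simp del: fun_upd_apply, auto)
qed

lemma convex_polygon_vertices:
  assumes "convex_polygon K"
  shows "convex K" "interior K \<noteq> {}" "finite {x. x extreme_point_of K}"
    "K = convex hull {x. x extreme_point_of K}"
proof -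
  have K: "polytope K" using assms by (simp add: convex_polygon_def)
  show "convex K" by (rule polytope_imp_convex[OF K])
  show "finite {x. x extreme_point_of K}"
    by (rule finite_polyhedron_extreme_points[OF polytope_imp_polyhedron[OF K]])
  show "K = convex hull {x. x extreme_point_of K}"
    by (rule Krein_Milman_Minkowski[OF polytope_imp_compact[OF K] polytope_imp_convex[OF K]])
  show "interior K \<noteq> {}" using assms by (simp add: convex_polygon_def)
qed

section \<open>Convex position and the cyclic order of the vertices\<close>

lemma extreme_not_between:
  "x extreme_point_of K \<Longrightarrow> a \<in> K \<Longrightarrow> b \<in> K \<Longrightarrow> a \<noteq> x \<Longrightarrow> b \<noteq> x \<Longrightarrow> x \<notin> closed_segment a b"
  by (auto simp: extreme_point_of_def open_segment_def)

lemma extreme_in: "x extreme_point_of K \<Longrightarrow> x \<in> K"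
  by (simp add: extreme_point_of_def)

lemma extreme_triangle:
  assumes "a extreme_point_of K" "b extreme_point_of K" "c extreme_point_of K"
    "a \<noteq> b" "a \<noteq> c" "b \<noteq> c"
  shows "triangle a b c"
  unfolding triangle_def using assms extreme_not_between extreme_in by metis

text \<open>Cramer's rule: barycentric coordinates are quotients of signed areas.\<close>

lemma orient_barycentric:
  "orient q r x *\<^sub>R lift p + orient r p x *\<^sub>R lift q + orient p q x *\<^sub>R lift r = orient p q r *\<^sub>R lift x"
  by (simp add: vec_eq_iff forall_3 orient_def algebra_simps)

text \<open>A point with positive barycentric coordinates is strictly between \<open>p\<close> and
  the point \<open>m\<close> where the ray from \<open>p\<close> through it meets
  \<open>q r\<close>. Both ends are in \<open>K\<close>, which extremality forbids.\<close>

lemma extreme_not_in_triangle: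
  assumes K: "convex K" and x: "x extreme_point_of K" and "p \<in> K" "q \<in> K" "r \<in> K" "p \<noteq> x"
  shows "\<not> (orient q r x > 0 \<and> orient r p x > 0 \<and> orient p q x > 0)"
proof
  assume pos: "orient q r x > 0 \<and> orient r p x > 0 \<and> orient p q x > 0"
  let ?s = "orient r p x + orient p q x"
  have s: "?s > 0" using pos by simp
  let ?v = "orient r p x *\<^sub>R lift q + orient p q x *\<^sub>R lift r"
  have "?v $ 3 = ?s" by simp
  with s lift_exists[of ?v] obtain m where m: "lift m = (1 / ?s) *\<^sub>R ?v" by metis
  then have m': "?s *\<^sub>R lift m = ?v" using s by (simp add: scaleR_right_distrib)
  have "m \<in> closed_segment q r" by (rule closed_segment_liftI[OF m']) (use pos s in auto)
  then have mK: "m \<in> K" using assms by (meson closed_segment_subset subsetD)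
  have e: "orient p q r *\<^sub>R lift x = orient q r x *\<^sub>R lift p + ?s *\<^sub>R lift m"
    unfolding m' orient_barycentric[of q r x p, symmetric] by (simp add: add.assoc)
  have sum: "orient p q r = orient q r x + ?s" using arg_cong[OF e, of "\<lambda>v. v $ 3"] by simp
  have "x \<in> closed_segment p m" by (rule closed_segment_liftI[OF e]) (use pos s sum in auto)
  moreover have "m \<noteq> x"
  proof
    assume "m = x"
    then have "orient q r x *\<^sub>R lift x = orient q r x *\<^sub>R lift p" using e unfolding sum by (simp add: scaleR_left_distrib)
    from lift_scaleR_eq[OF this] pos assms(6) show False by simp
  qed
  ultimately show False using extreme_not_between[OF x \<open>p \<in> K\<close> mK \<open>p \<noteq> x\<close>] by blast
qed

text \<open>Four lifts in three dimensions satisfy a linear relation with signed areas as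
  coefficients. The sign conditions put \<open>a\<close> and \<open>c\<close> on one side of it and
  \<open>b\<close> and \<open>d\<close> on the other, and the common value of the two sides
  normalises to the crossing point.\<close>

lemma diagonals_meet:
  assumes "orient a b c > 0" "orient a b d > 0" "orient a c d > 0" "orient b c d > 0"
  shows "closed_segment a c \<inter> closed_segment b d \<noteq> {}"
proof -
  let ?v = "orient b c d *\<^sub>R lift a + orient a b d *\<^sub>R lift c"
  let ?s = "orient b c d + orient a b d"
  have s: "?s > 0" using assms by simp
  have "?v $ 3 = ?s" by simp
  with s lift_exists[of ?v] obtain X where X: "lift X = (1 / ?s) *\<^sub>R ?v" by metis
  then have X1: "?s *\<^sub>R lift X = ?v" using s by (simp add: scaleR_right_distrib)
  have "?v = orient a c d *\<^sub>R lift b + orient a b c *\<^sub>R lift d"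
    by (simp add: vec_eq_iff forall_3 orient_def algebra_simps)
  with X1 have X2: "?s *\<^sub>R lift X = orient a c d *\<^sub>R lift b + orient a b c *\<^sub>R lift d" by simp
  have "X \<in> closed_segment a c" by (rule closed_segment_liftI[OF X1]) (use assms s in auto)
  moreover have "X \<in> closed_segment b d" by (rule closed_segment_liftI[OF X2]) (use assms s in auto)
  ultimately show ?thesis by blast
qed

lemma finite_least:
  assumes "finite A" "A \<noteq> {}"
    and "\<forall>x\<in>A. \<forall>y\<in>A. x \<noteq> y \<longrightarrow> R x y \<or> R y x"
    and "\<forall>x\<in>A. \<forall>y\<in>A. \<forall>z\<in>A. R x y \<longrightarrow> R y z \<longrightarrow> R x z"
  shows "\<exists>m\<in>A. \<forall>x\<in>A. x \<noteq> m \<longrightarrow> R m x"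
  using assms
proof (induction A rule: finite_ne_induct)
  case (singleton x)
  show ?case by simp
next
  case (insert x A)
  have "\<exists>m\<in>A. \<forall>x\<in>A. x \<noteq> m \<longrightarrow> R m x"
  proof (rule insert.IH)
    show "\<forall>x\<in>A. \<forall>y\<in>A. x \<noteq> y \<longrightarrow> R x y \<or> R y x"
      using insert.prems(1) by blast
    show "\<forall>x\<in>A. \<forall>y\<in>A. \<forall>z\<in>A. R x y \<longrightarrow> R y z \<longrightarrow> R x z"
      using insert.prems(2) by (intro ballI) (metis insertI2)
  qed
  then obtain m where m: "m \<in> A" "\<forall>x\<in>A. x \<noteq> m \<longrightarrow> R m x" by blast
  have "m \<noteq> x" using m insert.hyps by auto
  then consider "R m x" | "R x m" using insert.prems(1) m(1) by blast
  then show ?case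
  proof cases
    case 1
    then show ?thesis using m by blast
  next
    case 2
    then have "\<forall>y\<in>A. R x y"
      using insert.prems(2) m by (metis insertI1 insertI2)
    then show ?thesis by blast
  qed
qed

text \<open>Seen from \<open>v\<close>, the other vertices are linearly ordered by angle, and the
  neighbours \<open>l\<close> and \<open>m\<close> are the first and the last. Transitivity is where
  extremality enters: three vertices turning cyclically around \<open>v\<close> would enclose it in
  their triangle.\<close>

lemma adjacent_vertices:
  assumes K: "convex K" and fin: "finite {x. x extreme_point_of K}"
    and v: "v extreme_point_of K" and ne: "u extreme_point_of K" "u \<noteq> v"
  shows "\<exists>l m. l extreme_point_of K \<and> m extreme_point_of K \<and> l \<noteq> v \<and> m \<noteq> v \<and>
    (\<forall>x. x extreme_point_of K \<longrightarrow> x \<noteq> v \<longrightarrow> x \<noteq> l \<longrightarrow> orient v l x > 0) \<and>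
    (\<forall>x. x extreme_point_of K \<longrightarrow> x \<noteq> v \<longrightarrow> x \<noteq> m \<longrightarrow> orient v x m > 0)"
proof -
  define A where "A = {x. x extreme_point_of K} - {v}"
  have A: "finite A" "A \<noteq> {}" using fin ne by (auto simp: A_def)
  have swap: "orient v y x = - orient v x y" for x y
    by (simp add: orient_def algebra_simps)
  have total: "orient v x y > 0 \<or> orient v y x > 0" if "x \<in> A" "y \<in> A" "x \<noteq> y" for x y
  proof -
    have "triangle v x y" using that v by (intro extreme_triangle[of _ K]) (auto simp: A_def)
    then show ?thesis using swap[of x y] by (auto simp: triangle_iff_orient)
  qed
  have trans: "orient v x z > 0" if "x \<in> A" "y \<in> A" "z \<in> A" "orient v x y > 0" "orient v y z > 0" for x y z
  proof (rule ccontr)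
    assume n: "\<not> orient v x z > 0"
    have "x \<noteq> z" using that(4,5) swap[of x y] by auto
    then have "orient v z x > 0" using total[of x z] n that by auto
    moreover have "\<not> (orient y z v > 0 \<and> orient z x v > 0 \<and> orient x y v > 0)"
      using that by (intro extreme_not_in_triangle[OF K v]) (auto simp: A_def extreme_in)
    ultimately show False
      using that(4,5) orient_rotate[of v x y] orient_rotate[of v y z] orient_rotate[of v z x] by auto
  qed
  obtain l where l: "l \<in> A" "\<forall>x\<in>A. x \<noteq> l \<longrightarrow> orient v l x > 0"
    using finite_least[OF A, of "\<lambda>x y. orient v x y > 0"] total trans by blast
  obtain m where m: "m \<in> A" "\<forall>x\<in>A. x \<noteq> m \<longrightarrow> orient v x m > 0"
    using finite_least[OF A, of "\<lambda>x y. orient v y x > 0"] total trans by blast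
  show ?thesis by (intro exI[of _ l] exI[of _ m]) (use l m in \<open>auto simp: A_def\<close>)
qed

text \<open>With at most two vertices the polygon would lie in a segment, but a set with interior
  has points off every line.\<close>

lemma three_vertices:
  assumes "convex_polygon K"
  obtains a b c where "a extreme_point_of K" "b extreme_point_of K" "c extreme_point_of K"
    "a \<noteq> b" "a \<noteq> c" "b \<noteq> c"
proof (rule ccontr)
  assume no: "\<not> thesis"
  let ?E = "{x. x extreme_point_of K}"
  note K = convex_polygon_vertices[OF assms]
  have "\<exists>a b. ?E \<subseteq> {a, b}"
  proof (cases "\<exists>a b. a \<in> ?E \<and> b \<in> ?E \<and> a \<noteq> b")
    case True
    then obtain a b where "a \<in> ?E" "b \<in> ?E" "a \<noteq> b" by blast
    then have "?E \<subseteq> {a, b}" using no that[of a b] by blast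
    then show ?thesis by blast
  qed blast
  then obtain a b where "?E \<subseteq> {a, b}" by blast
  then have sub: "K \<subseteq> closed_segment a b"
    using K(4) hull_mono[of ?E "{a, b}" convex] by (simp add: segment_convex_hull)
  \<comment> \<open>A second point distinct from \<open>a\<close> even when the hull degenerates to
    a single point.\<close>
  define b' where "b' = (if a = b then a + axis 1 1 else b)"
  have "a \<noteq> b'" by (auto simp: b'_def)
  from exists_triangle_point[OF K(2) this] obtain u where u: "u \<in> K" "triangle u a b'" by blast
  have "u \<in> closed_segment a b" using sub u by blast
  then have "u \<in> closed_segment a b'" by (auto simp: b'_def)
  then show False using u(2) by (simp add: triangle_def)
qed

text \<open>\<open>v4 v1\<close>, \<open>v1 v2\<close> and \<open>v2 v3\<close> are three consecutive edges.\<close>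

lemma vertex_frame:
  assumes poly: "convex_polygon K"
  obtains
    (triangle) v1 v2 v3 where "{x. x extreme_point_of K} = {v1, v2, v3}" "v1 \<noteq> v2" "v1 \<noteq> v3" "v2 \<noteq> v3"
  | (quadrilateral) v1 v2 v3 v4 where "{v1, v2, v3, v4} \<subseteq> {x. x extreme_point_of K}"
      "distinct [v1, v2, v3, v4]" "closed_segment v1 v3 \<inter> closed_segment v4 v2 \<noteq> {}"
      "\<And>r. r extreme_point_of K \<Longrightarrow> r \<notin> {v1, v2, v3, v4} \<Longrightarrow>
         closed_segment v1 r \<inter> closed_segment v4 v2 \<noteq> {} \<and>
         closed_segment v2 r \<inter> closed_segment v1 v3 \<noteq> {}"
proof -
  note K = convex_polygon_vertices[OF poly]
  obtain v1 a b where abc: "v1 extreme_point_of K" "a extreme_point_of K" "b extreme_point_of K"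
    "v1 \<noteq> a" "v1 \<noteq> b" "a \<noteq> b"
    using three_vertices[OF poly] by blast
  \<comment> \<open>Counterclockwise, \<open>v2\<close> follows \<open>v1\<close> and
    \<open>v4\<close> precedes it; below, \<open>v3\<close> is taken as the successor of
    \<open>v2\<close>.\<close>
  obtain v2 v4 where v24: "v2 extreme_point_of K" "v4 extreme_point_of K" "v2 \<noteq> v1" "v4 \<noteq> v1"
    "\<forall>x. x extreme_point_of K \<longrightarrow> x \<noteq> v1 \<longrightarrow> x \<noteq> v2 \<longrightarrow> orient v1 v2 x > 0"
    "\<forall>x. x extreme_point_of K \<longrightarrow> x \<noteq> v1 \<longrightarrow> x \<noteq> v4 \<longrightarrow> orient v1 x v4 > 0"
    using adjacent_vertices[OF K(1,3) abc(1,2) abc(4)[symmetric]] by blast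
  obtain v3 where v3: "v3 extreme_point_of K" "v3 \<noteq> v2"
    "\<forall>x. x extreme_point_of K \<longrightarrow> x \<noteq> v2 \<longrightarrow> x \<noteq> v3 \<longrightarrow> orient v2 v3 x > 0"
    using adjacent_vertices[OF K(1,3) v24(1) abc(1) v24(3)[symmetric]] by blast
  have swap: "orient x z y = - orient x y z" for x y z
    by (simp add: orient_def algebra_simps)
  have zero: "orient x y y = 0" "orient x y x = 0" "orient x x y = 0" for x y
    by (simp_all add: orient_def)
  obtain c where c: "c extreme_point_of K" "c \<noteq> v1" "c \<noteq> v2" using abc by metis
  have v2c: "orient v1 v2 c > 0" using v24(5) c by blast
  have "v4 \<noteq> v2"
  proof
    assume "v4 = v2"
    then have "orient v1 c v2 > 0" using v24(6) c by blast
    then show False using v2c swap[of v1 c v2] by simp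
  qed
  have "v3 \<noteq> v1"
  proof
    assume "v3 = v1"
    then have "orient v2 v1 c > 0" using v3(3) c by blast
    then show False using v2c orient_swap[of v1 v2 c] by simp
  qed
  have inside: "\<not> (orient q r x > 0 \<and> orient r p x > 0 \<and> orient p q x > 0)"
    if "x extreme_point_of K" "p extreme_point_of K" "q extreme_point_of K" "r extreme_point_of K" "p \<noteq> x" for p q r x
    using that extreme_not_in_triangle[OF K(1)] extreme_in by blast
  have nz: "orient x y z \<noteq> 0" if "x extreme_point_of K" "y extreme_point_of K" "z extreme_point_of K"
    "x \<noteq> y" "x \<noteq> z" "y \<noteq> z" for x y z
    using extreme_triangle[OF that] triangle_iff_orient by blast
  show ?thesis
  proof (cases "v3 = v4")
    case True
    \<comment> \<open>The boundary closes up after three edges, and a further vertex would be to the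
      left of all three, hence inside the triangle.\<close>
    have "x \<in> {v1, v2, v3}" if x: "x extreme_point_of K" for x
    proof (rule ccontr)
      assume "x \<notin> {v1, v2, v3}"
      then have n: "x \<noteq> v1" "x \<noteq> v2" "x \<noteq> v3" by auto
      have "orient v1 x v3 > 0" using v24(6) x n True by simp
      then have "orient v3 v1 x > 0" using orient_rotate[of v3 v1 x] by simp
      moreover have "orient v1 v2 x > 0" using v24(5) x n by simp
      moreover have "orient v2 v3 x > 0" using v3(3) x n by simp
      ultimately show False using inside[OF x abc(1) v24(1) v3(1)] n by auto
    qed
    then have "{x. x extreme_point_of K} = {v1, v2, v3}" using abc(1) v24(1) v3(1) by blast
    then show ?thesis using triangle v24(3) v3(2) \<open>v3 \<noteq> v1\<close> by metis
  next
    case False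
    have 124: "orient v1 v2 v4 > 0" using v24(5,2,4) \<open>v4 \<noteq> v2\<close> by blast
    have 123: "orient v1 v2 v3 > 0" using v24(5) v3(1,2) \<open>v3 \<noteq> v1\<close> by blast
    have 134: "orient v1 v3 v4 > 0" using v24(6) v3(1) \<open>v3 \<noteq> v1\<close> False by blast
    have 234: "orient v2 v3 v4 > 0" using v3(3) v24(2) \<open>v4 \<noteq> v2\<close> False by blast
    have "closed_segment v1 v3 \<inter> closed_segment v2 v4 \<noteq> {}"
      by (intro diagonals_meet 123 124 134 234)
    moreover have "closed_segment v1 r \<inter> closed_segment v4 v2 \<noteq> {} \<and>
         closed_segment v2 r \<inter> closed_segment v1 v3 \<noteq> {}"
      if r: "r extreme_point_of K" and "r \<notin> {v1, v2, v3, v4}" for r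
    proof -
      have n: "r \<noteq> v1" "r \<noteq> v2" "r \<noteq> v3" "r \<noteq> v4" using that by auto
      have 12: "orient v1 v2 r > 0" using v24(5) r n by blast
      have 23: "orient v2 v3 r > 0" using v3(3) r n by blast
      have 14: "orient v1 r v4 > 0" using v24(6) r n by blast
      \<comment> \<open>Adjacency leaves undecided on which side of the diagonals
        \<open>v2 v4\<close> and \<open>v1 v3\<close> the vertex \<open>r\<close> lies. The other
        side would put it inside the triangle \<open>v1 v2 v4\<close> or
        \<open>v1 v2 v3\<close>.\<close>
      have "\<not> orient v2 v4 r > 0"
        using inside[OF r abc(1) v24(1) v24(2)] n 12 14 orient_rotate[of v4 v1 r] by auto
      then have 24: "orient v2 r v4 > 0"
        using nz[OF v24(1,2) r] n \<open>v4 \<noteq> v2\<close> swap[of v2 r v4] by auto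
      have "\<not> orient v3 v1 r > 0"
        using inside[OF r abc(1) v24(1) v3(1)] n 12 23 by auto
      then have "orient v1 v3 r > 0"
        using nz[OF abc(1) v3(1) r] n \<open>v3 \<noteq> v1\<close> orient_swap[of v1 v3 r] by auto
      then have "closed_segment v1 v3 \<inter> closed_segment v2 r \<noteq> {}"
        by (intro diagonals_meet 123 12 23)
      moreover have "closed_segment v1 r \<inter> closed_segment v2 v4 \<noteq> {}"
        by (intro diagonals_meet 124 12 14 24)
      ultimately show ?thesis by (auto simp: closed_segment_commute)
    qed
    ultimately show ?thesis
      using abc(1) v24(1-4) v3(1,2) False \<open>v3 \<noteq> v1\<close> \<open>v4 \<noteq> v2\<close>
      by (intro quadrilateral[of v1 v2 v3 v4]) (auto simp: closed_segment_commute)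
  qed
qed

section \<open>Projective transformations\<close>

lemma affine_point_lift: "affine_point p = span {lift p}"
  by (simp add: affine_point_def lift_def)

lemma span_singleton_eq_iff:
  fixes u v :: "'a::real_vector"
  assumes "u \<noteq> 0"
  shows "span {u} = span {v} \<longleftrightarrow> (\<exists>c. c \<noteq> 0 \<and> u = c *\<^sub>R v)"
proof
  assume "span {u} = span {v}"
  then have "u \<in> span {v}" using span_base[of u "{u}"] by simp
  then obtain c where "u = c *\<^sub>R v" by (auto simp: span_singleton)
  with assms show "\<exists>c. c \<noteq> 0 \<and> u = c *\<^sub>R v" by auto
next
  assume "\<exists>c. c \<noteq> 0 \<and> u = c *\<^sub>R v"
  then obtain c where c: "c \<noteq> 0" "u = c *\<^sub>R v" by blast
  have "k *\<^sub>R v \<in> range (\<lambda>k. k *\<^sub>R u)" for k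
    using c by (intro image_eqI[of _ _ "k / c"]) auto
  then show "span {u} = span {v}" unfolding span_singleton using c by auto
qed

lemma invertible_mult_eq_0_iff:
  fixes A :: "real^'n^'n"
  assumes "invertible A"
  shows "A *v v = 0 \<longleftrightarrow> v = 0"
  using assms matrix_left_invertible_ker[of A] by (auto simp: invertible_left_inverse)

text \<open>In matrix form the condition on the singular line is carried by
  \<open>c \<noteq> 0\<close>: a nonzero multiple of a lift has nonzero third coordinate, so its
  span is not at infinity.\<close>

lemma projectively_equivalent_iff:
  "projectively_equivalent P Q \<longleftrightarrow> (\<exists>A :: real^3^3. invertible A \<and>
    (\<forall>p\<in>P. \<exists>q\<in>Q. \<exists>c. c \<noteq> 0 \<and> A *v lift p = c *\<^sub>R lift q) \<and>
    (\<forall>q\<in>Q. \<exists>p\<in>P. \<exists>c. c \<noteq> 0 \<and> A *v lift p = c *\<^sub>R lift q))"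
proof -
  have RP: "affine_point p \<in> RP2" for p
    unfolding RP2_def affine_point_lift using lift_nonzero[of p] by blast
  define T :: "real^3^3 \<Rightarrow> (real^3) set \<Rightarrow> (real^3) set" where
    "T A = restrict (\<lambda>L. (\<lambda>v. A *v v) ` L) RP2" for A
  have T: "T A (affine_point p) = span {A *v lift p}" for A p
    using RP[of p] linear_span_image[OF matrix_vector_mul_linear[of A], of "{lift p}"]
    by (simp add: T_def affine_point_lift)
  have key: "T A (affine_point p) = affine_point q \<longleftrightarrow> (\<exists>c. c \<noteq> 0 \<and> A *v lift p = c *\<^sub>R lift q)"
    if "invertible A" for A p q
    unfolding T unfolding affine_point_lift
    by (rule span_singleton_eq_iff) (simp add: invertible_mult_eq_0_iff[OF that])
  have sing: "singular_line (T A) \<inter> affine_point ` P = {}"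
    if "T A ` affine_point ` P = affine_point ` Q" for A
  proof -
    have "affine_point q \<notin> line_at_infinity" for q
      using span_base[of "lift q" "{lift q}"]
      by (auto simp: line_at_infinity_def affine_point_lift intro!: bexI[of _ "lift q"])
    then have "T A (affine_point p) \<notin> line_at_infinity" if "p \<in> P" for p
      using \<open>T A ` affine_point ` P = affine_point ` Q\<close> that by (metis image_iff)
    then show ?thesis by (auto simp: singular_line_def)
  qed
  have im: "T A ` affine_point ` P = affine_point ` Q \<longleftrightarrow>
    (\<forall>p\<in>P. \<exists>q\<in>Q. T A (affine_point p) = affine_point q) \<and>
    (\<forall>q\<in>Q. \<exists>p\<in>P. T A (affine_point p) = affine_point q)" for A
    by (auto simp: image_image set_eq_iff image_iff) metis+
  have "projectively_equivalent P Q \<longleftrightarrow>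
    (\<exists>A. invertible A \<and> T A ` affine_point ` P = affine_point ` Q)"
  proof
    assume "projectively_equivalent P Q"
    then obtain F where F: "F \<in> PGL3" "F ` affine_point ` P = affine_point ` Q"
      unfolding projectively_equivalent_def by auto
    from F(1) obtain A where "invertible A" "F = T A"
      unfolding PGL3_def T_def by auto
    with F(2) show "\<exists>A. invertible A \<and> T A ` affine_point ` P = affine_point ` Q" by auto
  next
    assume "\<exists>A. invertible A \<and> T A ` affine_point ` P = affine_point ` Q"
    then obtain A where A: "invertible A" "T A ` affine_point ` P = affine_point ` Q" by blast
    have "T A \<in> PGL3" unfolding PGL3_def T_def using A(1) by auto
    with A(2) sing[OF A(2)] show "projectively_equivalent P Q"
      unfolding projectively_equivalent_def by (intro bexI[of _ "T A"]) simp_all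
  qed
  then show ?thesis unfolding im using key by (simp cong: conj_cong)
qed

text \<open>A linear map respects cones, and scale factors of one sign keep the weights nonnegative.
  Multiplying by \<open>c x\<close> turns them into the products in \<open>pos\<close>, which treats
  both common signs at once.\<close>

lemma projective_preserves_between:
  assumes A: "invertible (A :: real^3^3)" and "c a *\<^sub>R lift (f a) = A *v lift a"
    "c x *\<^sub>R lift (f x) = A *v lift x" "c b *\<^sub>R lift (f b) = A *v lift b"
    and pos: "c a * c x > 0" "c b * c x > 0"
  shows "x \<in> closed_segment a b \<longleftrightarrow> f x \<in> closed_segment (f a) (f b)"
proof
  assume "x \<in> closed_segment a b"
  then obtain \<alpha> \<beta> where l: "\<alpha> \<ge> 0" "\<beta> \<ge> 0" "lift x = \<alpha> *\<^sub>R lift a + \<beta> *\<^sub>R lift b"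
    unfolding closed_segment_lift by blast
  have "c x *\<^sub>R lift (f x) = \<alpha> *\<^sub>R (c a *\<^sub>R lift (f a)) + \<beta> *\<^sub>R (c b *\<^sub>R lift (f b))"
    unfolding assms(2-4) l(3)
    by (simp add: matrix_vector_right_distrib matrix_vector_mult_scaleR)
  then have "c x *\<^sub>R (c x *\<^sub>R lift (f x)) =
      c x *\<^sub>R (\<alpha> *\<^sub>R (c a *\<^sub>R lift (f a)) + \<beta> *\<^sub>R (c b *\<^sub>R lift (f b)))" by simp
  then have "(c x * c x) *\<^sub>R lift (f x) =
      (\<alpha> * (c a * c x)) *\<^sub>R lift (f a) + (\<beta> * (c b * c x)) *\<^sub>R lift (f b)"
    by (simp add: scaleR_right_distrib mult_ac)
  moreover have "\<alpha> * (c a * c x) \<ge> 0" "\<beta> * (c b * c x) \<ge> 0"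
    using l(1,2) pos by (auto intro: mult_nonneg_nonneg[OF _ less_imp_le])
  moreover have "c x \<noteq> 0" using pos by auto
  then have "c x * c x > 0" by (auto simp: zero_less_mult_iff)
  ultimately show "f x \<in> closed_segment (f a) (f b)"
    by (intro closed_segment_liftI)
next
  assume "f x \<in> closed_segment (f a) (f b)"
  then obtain \<alpha> \<beta> where l: "\<alpha> \<ge> 0" "\<beta> \<ge> 0" "lift (f x) = \<alpha> *\<^sub>R lift (f a) + \<beta> *\<^sub>R lift (f b)"
    unfolding closed_segment_lift by blast
  have nz: "c a \<noteq> 0" "c x \<noteq> 0" "c b \<noteq> 0" using pos by auto
  have "A *v lift x = c x *\<^sub>R (\<alpha> *\<^sub>R lift (f a) + \<beta> *\<^sub>R lift (f b))"
    unfolding l(3)[symmetric] by (rule assms(3)[symmetric])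
  also have "\<dots> = (c x * \<alpha> / c a) *\<^sub>R (c a *\<^sub>R lift (f a)) + (c x * \<beta> / c b) *\<^sub>R (c b *\<^sub>R lift (f b))"
    using nz by (simp add: scaleR_right_distrib)
  finally have "A *v lift x = (c x * \<alpha> / c a) *\<^sub>R (A *v lift a) + (c x * \<beta> / c b) *\<^sub>R (A *v lift b)"
    unfolding assms(2,4) .
  then have "A *v (lift x - ((c x * \<alpha> / c a) *\<^sub>R lift a + (c x * \<beta> / c b) *\<^sub>R lift b)) = 0"
    by (simp add: matrix_vector_right_distrib matrix_vector_mult_scaleR matrix_vector_mult_diff_distrib)
  then have "1 *\<^sub>R lift x = (c x * \<alpha> / c a) *\<^sub>R lift a + (c x * \<beta> / c b) *\<^sub>R lift b"
    unfolding invertible_mult_eq_0_iff[OF A] by simp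
  moreover have "c x / c a > 0" "c x / c b > 0"
    using pos by (auto simp: zero_less_mult_iff zero_less_divide_iff)
  then have "\<alpha> * (c x / c a) \<ge> 0" "\<beta> * (c x / c b) \<ge> 0"
    using l(1,2) by (metis mult_nonneg_nonneg less_imp_le)+
  then have "c x * \<alpha> / c a \<ge> 0" "c x * \<beta> / c b \<ge> 0" by (simp_all add: mult.commute)
  ultimately show "x \<in> closed_segment a b"
    by (rule closed_segment_liftI) simp
qed

text \<open>The scale factor \<open>c\<close> is affine in the point, being a third coordinate. On a
  convex set a change of sign would produce a zero, that is, a point on the singular line; so all
  factors share one sign and the map is an isomorphism.\<close>

lemma projectively_imp_elementarily_equivalent:
  assumes "projectively_equivalent P Q" "convex P" "P \<noteq> {}"
  shows "elementarily_equivalent (betweenness_struct P) (betweenness_struct Q)"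
proof -
  obtain A :: "real^3^3" where A: "invertible A"
    and PQ: "\<forall>p\<in>P. \<exists>q\<in>Q. \<exists>c. c \<noteq> 0 \<and> A *v lift p = c *\<^sub>R lift q"
    and QP: "\<forall>q\<in>Q. \<exists>p\<in>P. \<exists>c. c \<noteq> 0 \<and> A *v lift p = c *\<^sub>R lift q"
    using assms(1) unfolding projectively_equivalent_iff by blast
  obtain f c where f: "\<And>p. p \<in> P \<Longrightarrow> f p \<in> Q \<and> c p \<noteq> 0 \<and> A *v lift p = c p *\<^sub>R lift (f p)"
    using PQ by metis
  have c3: "c p = (A *v lift p) $ 3" if "p \<in> P" for p using f[OF that] by simp
  have pos: "c p * c q > 0" if p: "p \<in> P" and q: "q \<in> P" for p q
  proof (rule ccontr)
    assume "\<not> c p * c q > 0"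
    moreover have "c p * c q \<noteq> 0" using f[OF p] f[OF q] by simp
    ultimately have neg: "c p * c q < 0" by linarith
    \<comment> \<open>The parameter at which the affine function \<open>c\<close> vanishes between
      \<open>p\<close> and \<open>q\<close>.\<close>
    define u where "u = c p / (c p - c q)"
    have d: "c p - c q \<noteq> 0" using neg by (auto simp: mult_less_0_iff)
    have u: "0 \<le> u" "u \<le> 1" using neg by (auto simp: u_def mult_less_0_iff field_simps)
    define m where "m = (1 - u) *\<^sub>R p + u *\<^sub>R q"
    have m: "m \<in> P" unfolding m_def using assms(2) p q u by (simp add: convex_def)
    have "lift m = (1 - u) *\<^sub>R lift p + u *\<^sub>R lift q"
      by (simp add: vec_eq_iff forall_3 m_def)
    then have "(A *v lift m) $ 3 = (1 - u) * c p + u * c q"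
      by (simp add: matrix_vector_right_distrib c3[OF p] c3[OF q] matrix_vector_mult_scaleR)
    also have "\<dots> = c p - u * (c p - c q)" by (simp add: algebra_simps)
    also have "\<dots> = 0" using d by (simp add: u_def)
    finally have "c m = 0" unfolding c3[OF m] .
    then show False using f[OF m] by blast
  qed
  have unique: "p = p'" if "A *v lift p = k *\<^sub>R lift q" "A *v lift p' = k' *\<^sub>R lift q" "k \<noteq> 0" for p p' q k k'
  proof -
    have "A *v (k' *\<^sub>R lift p - k *\<^sub>R lift p') = 0"
      using that(1,2) by (simp add: matrix_vector_mult_diff_distrib matrix_vector_mult_scaleR)
    then have "k' *\<^sub>R lift p = k *\<^sub>R lift p'"
      unfolding invertible_mult_eq_0_iff[OF A] by simp
    from lift_scaleR_eq[OF this] that(3) show ?thesis by simp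
  qed
  have "inj_on f P"
  proof (rule inj_onI)
    fix p p' assume pp: "p \<in> P" "p' \<in> P" "f p = f p'"
    show "p = p'"
      by (rule unique[of p "c p" "f p" p' "c p'"]) (use f[OF pp(1)] f[OF pp(2)] pp(3) in auto)
  qed
  moreover have "f ` P = Q"
  proof
    show "f ` P \<subseteq> Q" using f by blast
    show "Q \<subseteq> f ` P"
    proof
      fix q assume "q \<in> Q"
      then obtain p k where p: "p \<in> P" "k \<noteq> 0" "A *v lift p = k *\<^sub>R lift q" using QP by blast
      then have "k *\<^sub>R lift q = c p *\<^sub>R lift (f p)" using f by simp
      from lift_scaleR_eq[OF this] p show "q \<in> f ` P" by blast
    qed
  qed
  ultimately have bij: "bij_betw f P Q" by (simp add: bij_betw_def)
  show ?thesis
  proof (rule elementarily_equivalent_iso[of f])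
    fix a x b
    assume "a \<in> fst (betweenness_struct P)" "x \<in> fst (betweenness_struct P)" "b \<in> fst (betweenness_struct P)"
    then have P: "a \<in> P" "x \<in> P" "b \<in> P" by simp_all
    show "snd (betweenness_struct P) a x b \<longleftrightarrow> snd (betweenness_struct Q) (f a) (f x) (f b)"
      unfolding betweenness_struct_simps
      by (rule projective_preserves_between[of A c])
        (use A P f[OF P(1)] f[OF P(2)] f[OF P(3)] pos in auto)
  qed (use bij assms(3) in simp_all)
qed

text \<open>A change of basis: \<open>C\<close> collects columns, and the lifts of a triangle form a
  basis. The scale factors stay free because the image of a fourth vertex has to fix them.\<close>

lemma matrix_exists:
  assumes "triangle a b c" "triangle a' b' c'" "p > 0" "q > 0" "r > 0"
  obtains A :: "real^3^3" where "invertible A"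
    "A *v lift a = p *\<^sub>R lift a'" "A *v lift b = q *\<^sub>R lift b'" "A *v lift c = r *\<^sub>R lift c'"
proof -
  define C :: "real^3 \<Rightarrow> real^3 \<Rightarrow> real^3 \<Rightarrow> real^3^3" where
    "C x y z = (\<chi> i. vector [x$i, y$i, z$i])" for x y z
  have C: "C x y z *v v = v$1 *\<^sub>R x + v$2 *\<^sub>R y + v$3 *\<^sub>R z" for x y z v
    by (simp add: C_def vec_eq_iff matrix_vector_mult_def sum_3 mult.commute)
  have inv: "invertible (C (p *\<^sub>R lift a) (q *\<^sub>R lift b) (r *\<^sub>R lift c))"
    if "triangle a b c" "p > 0" "q > 0" "r > 0" for a b c p q r
    unfolding invertible_left_inverse matrix_left_invertible_ker C
  proof (intro allI impI)
    fix v :: "real^3"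
    assume "v$1 *\<^sub>R p *\<^sub>R lift a + v$2 *\<^sub>R q *\<^sub>R lift b + v$3 *\<^sub>R r *\<^sub>R lift c = 0"
    then have "(v$1 * p) *\<^sub>R lift a + (v$2 * q) *\<^sub>R lift b + (v$3 * r) *\<^sub>R lift c = 0" by simp
    from triangle_independent[OF that(1) this] that(2-4) show "v = 0"
      by (simp add: vec_eq_iff forall_3)
  qed
  let ?M = "C (lift a) (lift b) (lift c)" and ?N = "C (p *\<^sub>R lift a') (q *\<^sub>R lift b') (r *\<^sub>R lift c')"
  have "invertible ?M" using inv[OF assms(1), of 1 1 1] by simp
  then obtain B where B: "?M ** B = mat 1" "B ** ?M = mat 1" unfolding invertible_def by blast
  then have cancel: "B *v (?M *v v) = v" for v
    by (simp add: matrix_vector_mul_assoc)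
  let ?A = "?N ** B"
  have A: "?A *v (?M *v v) = ?N *v v" for v
    by (simp only: matrix_vector_mul_assoc[symmetric] cancel)
  have "invertible B" using B unfolding invertible_def by blast
  then have "invertible ?A" using inv[OF assms(2-5)] by (rule invertible_mult[rotated])
  moreover have "?A *v lift a = p *\<^sub>R lift a'" using A[of "vector [1, 0, 0]"] by (simp add: C)
  moreover have "?A *v lift b = q *\<^sub>R lift b'" using A[of "vector [0, 1, 0]"] by (simp add: C)
  moreover have "?A *v lift c = r *\<^sub>R lift c'" using A[of "vector [0, 0, 1]"] by (simp add: C)
  ultimately show ?thesis using that by blast
qed

text \<open>The points sent to a positive multiple of a lift from \<open>Q\<close> form a convex
  set, because positive combinations of such images can be normalised again. It contains
  \<open>E\<close> and therefore its hull.\<close>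

lemma projective_image_hull:
  assumes "convex Q" and "\<And>p. p \<in> E \<Longrightarrow> \<exists>q\<in>Q. \<exists>c>0. A *v lift p = c *\<^sub>R lift q"
    and "p \<in> convex hull E"
  shows "\<exists>q\<in>Q. \<exists>c>0. (A :: real^3^3) *v lift p = c *\<^sub>R lift q"
proof -
  let ?S = "{p. \<exists>q\<in>Q. \<exists>c>0. A *v lift p = c *\<^sub>R lift q}"
  have "convex ?S"
  proof (rule convexI)
    fix x y and u v :: real
    assume xy: "x \<in> ?S" "y \<in> ?S" and uv: "0 \<le> u" "0 \<le> v" "u + v = 1"
    obtain x' c where x: "x' \<in> Q" "c > 0" "A *v lift x = c *\<^sub>R lift x'" using xy by blast
    obtain y' d where y: "y' \<in> Q" "d > 0" "A *v lift y = d *\<^sub>R lift y'" using xy by blast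
    have "lift (u *\<^sub>R x + v *\<^sub>R y) = u *\<^sub>R lift x + v *\<^sub>R lift y"
      using uv by (simp add: vec_eq_iff forall_3)
    then have e: "A *v lift (u *\<^sub>R x + v *\<^sub>R y) = (u * c) *\<^sub>R lift x' + (v * d) *\<^sub>R lift y'"
      using x y by (simp add: matrix_vector_right_distrib matrix_vector_mult_scaleR)
    have m: "u * c + v * d > 0"
    proof (cases "u = 0")
      case False
      then show ?thesis using uv x y by (simp add: add_pos_nonneg)
    qed (use uv y in simp)
    obtain z where z: "lift z = (1 / (u * c + v * d)) *\<^sub>R ((u * c) *\<^sub>R lift x' + (v * d) *\<^sub>R lift y')"
      using lift_exists[of "(u * c) *\<^sub>R lift x' + (v * d) *\<^sub>R lift y'"] m by auto
    then have z': "(u * c + v * d) *\<^sub>R lift z = (u * c) *\<^sub>R lift x' + (v * d) *\<^sub>R lift y'"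
      using m by simp
    have "z \<in> closed_segment x' y'" by (rule closed_segment_liftI[OF z']) (use uv x y m in auto)
    then have "z \<in> Q" using assms(1) x y by (meson closed_segment_subset subsetD)
    then show "u *\<^sub>R x + v *\<^sub>R y \<in> ?S"
      using m by (intro CollectI bexI[of _ z] exI[of _ "u * c + v * d"]) (simp_all only: e z')
  qed
  then have "convex hull E \<subseteq> ?S" using assms(2) by (intro hull_minimal) auto
  then show ?thesis using assms(3) by blast
qed

text \<open>Positivity of the factors at the vertices passes to the inverse matrix, so the hull
  argument applies in both directions.\<close>

lemma projectively_equivalentI:
  assumes "convex P" "convex Q" "P = convex hull E" "Q = convex hull F"
    and A: "invertible (A :: real^3^3)" and f: "f ` E = F"
    and vert: "\<And>v. v \<in> E \<Longrightarrow> \<exists>c>0. A *v lift v = c *\<^sub>R lift (f v)"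
  shows "projectively_equivalent P Q"
  unfolding projectively_equivalent_iff
proof (intro exI conjI ballI)
  show "invertible A" by (rule A)
next
  fix p assume "p \<in> P"
  moreover have "\<exists>q\<in>Q. \<exists>c>0. A *v lift v = c *\<^sub>R lift q" if "v \<in> E" for v
    using vert[OF that] that f assms(4) hull_inc[of "f v" F convex] by blast
  ultimately obtain q c where "q \<in> Q" "c > 0" "A *v lift p = c *\<^sub>R lift q"
    using assms(3) projective_image_hull[OF assms(2), of E A p] by blast
  then show "\<exists>q\<in>Q. \<exists>c. c \<noteq> 0 \<and> A *v lift p = c *\<^sub>R lift q"
    by (intro bexI[of _ q] exI[of _ c]) auto
next
  fix q assume q: "q \<in> Q"
  obtain B where "A ** B = mat 1" "B ** A = mat 1" using A unfolding invertible_def by blast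
  then have inv: "B *v (A *v v) = v" "A *v (B *v v) = v" for v
    by (simp_all add: matrix_vector_mul_assoc)
  have "\<exists>p\<in>P. \<exists>c>0. B *v lift w = c *\<^sub>R lift p" if w: "w \<in> F" for w
  proof -
    obtain v where v: "v \<in> E" "w = f v" using w f by blast
    then obtain c where c: "c > 0" "A *v lift v = c *\<^sub>R lift w" using vert by blast
    have "c *\<^sub>R (B *v lift w) = lift v" using inv(1)[of "lift v"] c(2) by (simp add: matrix_vector_mult_scaleR)
    then have "(1 / c) *\<^sub>R (c *\<^sub>R (B *v lift w)) = (1 / c) *\<^sub>R lift v" by simp
    then have "B *v lift w = (1 / c) *\<^sub>R lift v" using c by simp
    moreover have "v \<in> P" using v assms(3) by (simp add: hull_inc)
    ultimately show ?thesis using c(1) by (intro bexI[of _ v] exI[of _ "1 / c"]) auto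
  qed
  from projective_image_hull[OF assms(1) this, of F] q assms(4)
  obtain p c where p: "p \<in> P" "c > 0" "B *v lift q = c *\<^sub>R lift p" by blast
  then have "lift q = c *\<^sub>R (A *v lift p)" using inv(2)[of "lift q"] by (simp add: matrix_vector_mult_scaleR)
  then have "A *v lift p = (1 / c) *\<^sub>R lift q" using p(2) by simp
  then show "\<exists>p\<in>P. \<exists>c. c \<noteq> 0 \<and> A *v lift p = c *\<^sub>R lift q"
    using p by (intro bexI[of _ p] exI[of _ "1 / c"]) auto
qed

section \<open>Crossing diagonals\<close>

text \<open>Two distinct common points would span a line through \<open>a\<close>, \<open>b\<close>
  and \<open>c\<close>.\<close>

lemma crossing_unique:
  assumes "triangle a b c" "p \<in> closed_segment a b \<inter> closed_segment c d"
    "q \<in> closed_segment a b \<inter> closed_segment c d"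
  shows "p = q"
proof (rule ccontr)
  assume "p \<noteq> q"
  have on: "orient p q x = 0 \<and> orient p q y = 0"
    if pq: "p \<in> closed_segment x y" "q \<in> closed_segment x y" for x y
  proof -
    obtain s t where st: "p = (1 - s) *\<^sub>R x + s *\<^sub>R y" "q = (1 - t) *\<^sub>R x + t *\<^sub>R y"
      using pq by (auto simp: in_segment)
    have "p$1 = (1 - s) * x$1 + s * y$1" "p$2 = (1 - s) * x$2 + s * y$2"
      "q$1 = (1 - t) * x$1 + t * y$1" "q$2 = (1 - t) * x$2 + t * y$2"
      by (simp_all add: st)
    then show ?thesis unfolding orient_def by algebra
  qed
  have 0: "orient p q a = 0" "orient p q b = 0" "orient p q c = 0"
    using on[of a b] on[of c d] assms(2,3) by blast+
  have "(q$1 - p$1) * orient a b c = 0" "(q$2 - p$2) * orient a b c = 0"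
    using 0 unfolding orient_def by algebra+
  then show False using \<open>p \<noteq> q\<close> assms(1) by (auto simp: triangle_iff_orient vec_eq_iff forall_2)
qed

text \<open>Extreme points \<open>a\<close> and \<open>b\<close> cannot be on \<open>p q\<close>
  without being its endpoints, so the crossing avoids both coordinate 0 and coordinate
  infinity.\<close>

lemma crossing_pt:
  assumes ext: "a extreme_point_of K" "b extreme_point_of K" "p \<in> K" "q \<in> K"
    and ne: "a \<noteq> p" "a \<noteq> q" "b \<noteq> p" "b \<noteq> q"
    and z: "z \<in> closed_segment a b" "z \<in> closed_segment p q"
  obtains s where "s > 0" "z = pt a b s"
proof -
  have n: "z \<noteq> a" "z \<noteq> b"
    using z(2) extreme_not_between[OF ext(1,3,4)] extreme_not_between[OF ext(2,3,4)] ne by auto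
  obtain s where s: "s \<ge> 0" "z = pt a b s" using segment_pt[OF z(1) n(2)] by blast
  have "s \<noteq> 0" using s n by auto
  with s that[of s] show ?thesis by simp
qed

text \<open>Uniqueness of the crossing in \<open>Q\<close> makes its defining formula algebraic, so
  the crossing point can be added to the type.\<close>

lemma crossing_extend:
  assumes ty: "same_type {..<n} (betweenness_struct P) e (betweenness_struct Q) e'"
    and idx: "a < n" "b < n" "p < n" "q < n"
    and P: "convex P" "e a \<in> P" "e b \<in> P"
    and Q: "triangle (e' a) (e' b) (e' p)"
    and z: "z \<in> closed_segment (e a) (e b)" "z \<in> closed_segment (e p) (e q)"
  obtains z' where "same_type {..<Suc n} (betweenness_struct P) (e(n := z)) (betweenness_struct Q) (e'(n := z'))"
    "z' \<in> closed_segment (e' a) (e' b)" "z' \<in> closed_segment (e' p) (e' q)"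
proof -
  let ?\<psi> = "Conj (Bet a n b) (Bet p n q)"
  have sat: "sat (betweenness_struct K) (g(n := y)) ?\<psi> \<longleftrightarrow>
    y \<in> closed_segment (g a) (g b) \<and> y \<in> closed_segment (g p) (g q)" for K g y
    using idx by simp
  have zP: "z \<in> P" using z(1) P by (meson closed_segment_subset subsetD)
  let ?I = "closed_segment (e' a) (e' b) \<inter> closed_segment (e' p) (e' q)"
  have "finite ?I"
  proof (cases "?I = {}")
    case False
    then obtain y where "y \<in> ?I" by blast
    then have "?I \<subseteq> {y}" using crossing_unique[OF Q] by blast
    then show ?thesis by (rule finite_subset) simp
  qed simp
  then have fin: "finite {y \<in> Q. sat (betweenness_struct Q) (e'(n := y)) ?\<psi>}"
    by (rule rev_finite_subset) (unfold sat, blast)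
  have "free_vars ?\<psi> \<subseteq> insert n {..<n}" using idx by auto
  then have "\<exists>y\<in>fst (betweenness_struct Q). sat (betweenness_struct Q) (e'(n := y)) ?\<psi> \<and>
    same_type (insert n {..<n}) (betweenness_struct P) (e(n := z)) (betweenness_struct Q) (e'(n := y))"
    by (rule same_type_extend[OF ty])
      (unfold betweenness_struct_simps sat, use zP z fin[unfolded sat] in simp_all)
  then show ?thesis using that unfolding sat lessThan_Suc by blast
qed

text \<open>\<open>x\<close> indexes a reference point on the diagonal. The quotient
  \<open>s / u\<close> is a cross ratio with \<open>a\<close> at 0 and \<open>b\<close> at infinity,
  hence determined by the type.\<close>

lemma crossing_ratio:
  assumes poly: "convex_polygon P" "convex_polygon Q"
    and ty: "same_type {..<n} (betweenness_struct P) e (betweenness_struct Q) e'"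
    and idx: "a < n" "b < n" "p < n" "q < n" "x < n"
    and P: "e a extreme_point_of P" "e b extreme_point_of P" "e p \<in> P" "e q \<in> P"
      "e a \<noteq> e b" "e a \<noteq> e p" "e a \<noteq> e q" "e b \<noteq> e p" "e b \<noteq> e q"
    and Q: "e' a extreme_point_of Q" "e' b extreme_point_of Q" "e' p extreme_point_of Q" "e' q \<in> Q"
      "e' a \<noteq> e' b" "e' a \<noteq> e' p" "e' a \<noteq> e' q" "e' b \<noteq> e' p" "e' b \<noteq> e' q"
    and x: "e x = pt (e a) (e b) u" "u > 0" "e' x = pt (e' a) (e' b) u'" "u' > 0"
    and meet: "closed_segment (e p) (e q) \<inter> closed_segment (e a) (e b) \<noteq> {}"
  obtains s s' where "s > 0" "s' > 0" "s / u = s' / u'"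
    "pt (e a) (e b) s \<in> closed_segment (e p) (e q)"
    "pt (e' a) (e' b) s' \<in> closed_segment (e' p) (e' q)"
proof -
  note cP = convex_polygon_vertices[OF poly(1)] and cQ = convex_polygon_vertices[OF poly(2)]
  obtain z where z: "z \<in> closed_segment (e a) (e b)" "z \<in> closed_segment (e p) (e q)"
    using meet by blast
  have tri: "triangle (e' a) (e' b) (e' p)"
    by (rule extreme_triangle[OF Q(1-3,5,6,8)])
  obtain z' where ty': "same_type {..<Suc n} (betweenness_struct P) (e(n := z)) (betweenness_struct Q) (e'(n := z'))"
    and z': "z' \<in> closed_segment (e' a) (e' b)" "z' \<in> closed_segment (e' p) (e' q)"
    using crossing_extend[OF ty idx(1-4) cP(1) P(1,2)[THEN extreme_in] tri z] by blast
  obtain s where s: "s > 0" "z = pt (e a) (e b) s"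
    using crossing_pt[OF P(1-4,6-9) z] by blast
  obtain s' where s': "s' > 0" "z' = pt (e' a) (e' b) s'"
    using crossing_pt[OF Q(1,2) extreme_in[OF Q(3)] Q(4,6-9) z'] by blast
  have "s / u = s' / u'"
    by (rule ratio_eq[OF cP(1,2) P(1,2)[THEN extreme_in] P(5)
          cQ(1,2) Q(1,2)[THEN extreme_in] Q(5) ty', of a b x n])
      (use idx x s s' in simp_all)
  with that[of s s'] s s' z z' show ?thesis by simp
qed

text \<open>The crossing point is expanded along each of the two diagonals; equating the expansions
  and solving for \<open>lift v4\<close> gives its coordinates in the other three vertices.\<close>

lemma crossing_coords:
  assumes "pt v4 v2 x = pt v1 v3 y" "x > 0" "y > 0"
  shows "lift v4 = ((1 + x) / (1 + y)) *\<^sub>R lift v1 + (- x) *\<^sub>R lift v2 + ((1 + x) / (1 + y) * y) *\<^sub>R lift v3"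
proof -
  have "lift v4 = (1 + x) *\<^sub>R lift (pt v4 v2 x) - x *\<^sub>R lift v2"
    using lift_pt[of x v4 v2] assms(2) by simp
  also have "(1 + x) *\<^sub>R lift (pt v4 v2 x) = ((1 + x) / (1 + y)) *\<^sub>R ((1 + y) *\<^sub>R lift (pt v1 v3 y))"
    unfolding assms(1) using assms(3) by simp
  also have "(1 + y) *\<^sub>R lift (pt v1 v3 y) = lift v1 + y *\<^sub>R lift v3"
    using lift_pt[of y v1 v3] assms(3) by simp
  finally show ?thesis by (simp add: scaleR_right_distrib)
qed

text \<open>\<open>r\<close> is located by the points in which \<open>v1 r\<close> and \<open>v2 r\<close> cross the diagonals of \<open>v1 v2 v3 v4\<close>.\<close>

lemma vertex_coords:
  assumes tri: "triangle v1 v2 v3"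
    and X: "pt v4 v2 x = pt v1 v3 y" "x > 0" "y > 0"
    and c: "pt v4 v2 s \<in> closed_segment v1 r" "pt v4 v2 s \<noteq> v1" "s > 0"
    and d: "pt v1 v3 t \<in> closed_segment v2 r" "pt v1 v3 t \<noteq> v2" "t > 0"
    and k: "k = (1 + x) / (1 + y)"
  obtains z where "z > 0"
    "lift r = z *\<^sub>R ((k * y / t) *\<^sub>R lift v1 + (s - x) *\<^sub>R lift v2 + (k * y) *\<^sub>R lift v3)"
proof -
  obtain \<alpha> u where c': "u \<ge> 0" "lift (pt v4 v2 s) = \<alpha> *\<^sub>R lift v1 + u *\<^sub>R lift r"
    using c(1) unfolding closed_segment_lift by blast
  have "u \<noteq> 0"
  proof
    assume "u = 0"
    then have "1 *\<^sub>R lift (pt v4 v2 s) = \<alpha> *\<^sub>R lift v1" using c'(2) by simp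
    from lift_scaleR_eq[OF this] c(2) show False by simp
  qed
  obtain \<beta> w where d': "w \<ge> 0" "lift (pt v1 v3 t) = \<beta> *\<^sub>R lift v2 + w *\<^sub>R lift r"
    using d(1) unfolding closed_segment_lift by blast
  have "w \<noteq> 0"
  proof
    assume "w = 0"
    then have "1 *\<^sub>R lift (pt v1 v3 t) = \<beta> *\<^sub>R lift v2" using d'(2) by simp
    from lift_scaleR_eq[OF this] d(2) show False by simp
  qed
  define m n where "m = (1 + s) * u" and "n = (1 + t) * w"
  have mn: "m > 0" "n > 0" unfolding m_def n_def using c' d' c(3) d(3) \<open>u \<noteq> 0\<close> \<open>w \<noteq> 0\<close> by simp_all
  have v4: "lift v4 = k *\<^sub>R lift v1 + (- x) *\<^sub>R lift v2 + (k * y) *\<^sub>R lift v3"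
    unfolding k by (rule crossing_coords[OF X])
  have "(1 + s) *\<^sub>R (\<alpha> *\<^sub>R lift v1 + u *\<^sub>R lift r) = lift v4 + s *\<^sub>R lift v2"
    using lift_pt[of s v4 v2] c(3) unfolding c'(2) by simp
  then have rm: "m *\<^sub>R lift r = (k - (1 + s) * \<alpha>) *\<^sub>R lift v1 + (s - x) *\<^sub>R lift v2 + (k * y) *\<^sub>R lift v3"
    unfolding v4 m_def by (simp add: algebra_simps)
  have "(1 + t) *\<^sub>R (\<beta> *\<^sub>R lift v2 + w *\<^sub>R lift r) = lift v1 + t *\<^sub>R lift v3"
    using lift_pt[of t v1 v3] d(3) unfolding d'(2) by simp
  then have rn: "n *\<^sub>R lift r = 1 *\<^sub>R lift v1 + (- ((1 + t) * \<beta>)) *\<^sub>R lift v2 + t *\<^sub>R lift v3"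
    unfolding n_def by (simp add: algebra_simps)
  \<comment> \<open>The crossing on \<open>v1 r\<close> determines \<open>r\<close> except for its
    coordinate along \<open>v1\<close>, the one on \<open>v2 r\<close> except for that along
    \<open>v2\<close>. The coordinate along \<open>v3\<close>, known in both, relates the scales
    \<open>m\<close> and \<open>n\<close> and so yields the one along \<open>v1\<close>.\<close>
  have "n *\<^sub>R (m *\<^sub>R lift r) = m *\<^sub>R (n *\<^sub>R lift r)" by (simp add: mult.commute)
  then have "(n * (k - (1 + s) * \<alpha>)) *\<^sub>R lift v1 + (n * (s - x)) *\<^sub>R lift v2 + (n * (k * y)) *\<^sub>R lift v3
    = m *\<^sub>R lift v1 + (m * (- ((1 + t) * \<beta>))) *\<^sub>R lift v2 + (m * t) *\<^sub>R lift v3"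
    unfolding rm rn by (simp only: scaleR_right_distrib scaleR_scaleR mult_1_right)
  from triangle_coords_unique[OF tri this]
  have e: "n * (k - (1 + s) * \<alpha>) = m" "n * (k * y) = m * t" by auto
  have "n * (k * y / t) = m" using e(2) d(3) by (simp add: field_simps)
  with e(1) mn have "k - (1 + s) * \<alpha> = k * y / t" by (metis mult_cancel_left less_irrefl)
  with rm have "m *\<^sub>R lift r = (k * y / t) *\<^sub>R lift v1 + (s - x) *\<^sub>R lift v2 + (k * y) *\<^sub>R lift v3" by simp
  then have "lift r = (1 / m) *\<^sub>R ((k * y / t) *\<^sub>R lift v1 + (s - x) *\<^sub>R lift v2 + (k * y) *\<^sub>R lift v3)"
    using mn by (metis divide_self_if less_irrefl scaleR_one scaleR_scaleR times_divide_eq_left mult_1_left)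
  with that[of "1 / m"] mn show ?thesis by simp
qed

text \<open>Injectivity transfers through equality formulas. For surjectivity the type is extended
  backwards: the partner \<open>x\<close> in \<open>P\<close> of a vertex \<open>y\<close> of
  \<open>Q\<close> is already enumerated at some \<open>i\<close>, so \<open>y\<close> equals
  \<open>w i\<close>.\<close>

lemma same_type_vertex_bijection:
  assumes poly: "convex_polygon P" "convex_polygon Q"
    and ee: "elementarily_equivalent (betweenness_struct P) (betweenness_struct Q)"
  obtains n v w f where "same_type {..<n} (betweenness_struct P) v (betweenness_struct Q) w"
    "inj_on f {x. x extreme_point_of P}" "f ` {x. x extreme_point_of P} = {y. y extreme_point_of Q}"
    "\<And>x. x extreme_point_of P \<Longrightarrow> \<exists>i<n. v i = x \<and> w i = f x"
proof -
  note cP = convex_polygon_vertices[OF poly(1)] and cQ = convex_polygon_vertices[OF poly(2)]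
  let ?E = "{x. x extreme_point_of P}"
  obtain v where v: "bij_betw v {0..<card ?E} ?E"
    using ex_bij_betw_nat_finite[OF cP(3)] by blast
  define n where "n = card ?E"
  have v_ext: "v i extreme_point_of P" if "i < n" for i
    using v that unfolding bij_betw_def n_def by auto
  have v_all: "\<exists>i<n. v i = x" if "x extreme_point_of P" for x
  proof -
    have "x \<in> v ` {0..<n}" using v that unfolding bij_betw_def n_def by auto
    then show ?thesis by auto
  qed
  have ne: "P \<noteq> {}" "Q \<noteq> {}" using cP(2) cQ(2) interior_empty by metis+
  obtain w where ty: "same_type {..<n} (betweenness_struct P) v (betweenness_struct Q) w"
    and w_ext: "\<forall>i<n. w i extreme_point_of Q"
    using same_type_vertices[OF ee ne cQ(3), of n v] v_ext by blast
  have eq: "v i = v j \<longleftrightarrow> w i = w j" if "i < n" "j < n" for i j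
    using same_type_eq[OF ty, of i j] that by simp
  define f where "f x = w (SOME i. i < n \<and> v i = x)" for x
  have f: "\<exists>i<n. v i = x \<and> w i = f x" if x: "x extreme_point_of P" for x
  proof -
    have "(SOME i. i < n \<and> v i = x) < n \<and> v (SOME i. i < n \<and> v i = x) = x"
      by (rule someI_ex) (use v_all[OF x] in blast)
    then show ?thesis unfolding f_def by blast
  qed
  have "inj_on f ?E"
  proof (rule inj_onI)
    fix x y assume "x \<in> ?E" "y \<in> ?E" and fxy: "f x = f y"
    then obtain i j where "i < n" "v i = x" "w i = f x" "j < n" "v j = y" "w j = f y"
      using f[of x] f[of y] by auto
    then show "x = y" using eq[of i j] fxy by simp
  qed
  moreover have "f ` ?E = {y. y extreme_point_of Q}"
  proof
    show "f ` ?E \<subseteq> {y. y extreme_point_of Q}"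
    proof
      fix y assume "y \<in> f ` ?E"
      then obtain x where "x extreme_point_of P" "y = f x" by blast
      then obtain i where "i < n" "w i = y" using f[of x] by auto
      then show "y \<in> {y. y extreme_point_of Q}" using w_ext by auto
    qed
    show "{y. y extreme_point_of Q} \<subseteq> f ` ?E"
    proof
      fix y assume "y \<in> {y. y extreme_point_of Q}"
      then have y: "y extreme_point_of Q" by simp
      obtain x where x: "x extreme_point_of P" and ty':
        "same_type {..<Suc n} (betweenness_struct Q) (w(n := y)) (betweenness_struct P) (v(n := x))"
        using same_type_extend_vertex[OF same_type_sym[OF ty] y cP(3)] by blast
      obtain i where i: "i < n" "v i = x" "w i = f x" using f[OF x] by blast
      have "(w(n := y)) i = (w(n := y)) n \<longleftrightarrow> (v(n := x)) i = (v(n := x)) n"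
        by (rule same_type_eq[OF ty']) (use i in auto)
      then have "y = f x" using i by simp
      then show "y \<in> f ` ?E" using x by blast
    qed
  qed
  ultimately show ?thesis using that[OF ty] f by blast
qed

lemma elementarily_imp_projectively_equivalent:
  assumes poly: "convex_polygon P" "convex_polygon Q"
    and ee: "elementarily_equivalent (betweenness_struct P) (betweenness_struct Q)"
  shows "projectively_equivalent P Q"
proof -
  note cP = convex_polygon_vertices[OF poly(1)] and cQ = convex_polygon_vertices[OF poly(2)]
  let ?E = "{x. x extreme_point_of P}"
  obtain n v w f where ty: "same_type {..<n} (betweenness_struct P) v (betweenness_struct Q) w"
    and inj: "inj_on f ?E" and im: "f ` ?E = {y. y extreme_point_of Q}"
    and ind: "\<And>x. x extreme_point_of P \<Longrightarrow> \<exists>i<n. v i = x \<and> w i = f x"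
    using same_type_vertex_bijection[OF poly ee] by blast
  have fQ: "f x extreme_point_of Q" if "x extreme_point_of P" for x
    using im that by blast
  have fne: "f x \<noteq> f y" if "x extreme_point_of P" "y extreme_point_of P" "x \<noteq> y" for x y
    using inj that by (auto simp: inj_on_def)
  show ?thesis
  proof (cases rule: vertex_frame[OF poly(1), case_names triangle quadrilateral])
    case (triangle v1 v2 v3)
    then have e: "v1 extreme_point_of P" "v2 extreme_point_of P" "v3 extreme_point_of P" by auto
    have t: "triangle v1 v2 v3" using extreme_triangle[OF e] triangle by blast
    have t': "triangle (f v1) (f v2) (f v3)"
      using extreme_triangle[OF fQ[OF e(1)] fQ[OF e(2)] fQ[OF e(3)]] fne e triangle by blast
    \<comment> \<open>Any two triangles are affinely equivalent, so all scale factors can be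
      1.\<close>
    obtain A :: "real^3^3" where A: "invertible A"
      "A *v lift v1 = 1 *\<^sub>R lift (f v1)" "A *v lift v2 = 1 *\<^sub>R lift (f v2)" "A *v lift v3 = 1 *\<^sub>R lift (f v3)"
      using matrix_exists[OF t t', of 1 1 1] by auto
    show ?thesis
    proof (rule projectively_equivalentI[OF cP(1) cQ(1) cP(4) cQ(4) A(1) im])
      fix x assume "x \<in> ?E"
      then have "x = v1 \<or> x = v2 \<or> x = v3" using triangle(1) by blast
      then show "\<exists>c>0. A *v lift x = c *\<^sub>R lift (f x)" using A zero_less_one by metis
    qed
  next
    case (quadrilateral v1 v2 v3 v4)
    then have e: "v1 extreme_point_of P" "v2 extreme_point_of P" "v3 extreme_point_of P"
      "v4 extreme_point_of P" by auto
    have d: "v1 \<noteq> v2" "v1 \<noteq> v3" "v1 \<noteq> v4" "v2 \<noteq> v3" "v2 \<noteq> v4" "v3 \<noteq> v4"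
      using quadrilateral(2) by auto
    note e' = fQ[OF e(1)] fQ[OF e(2)] fQ[OF e(3)] fQ[OF e(4)]
    have d': "f v1 \<noteq> f v2" "f v1 \<noteq> f v3" "f v1 \<noteq> f v4" "f v2 \<noteq> f v3" "f v2 \<noteq> f v4" "f v3 \<noteq> f v4"
      using d e fne by blast+
    note eK = e[THEN extreme_in] and eK' = e'[THEN extreme_in]
    obtain i1 where i1: "i1 < n" "v i1 = v1" "w i1 = f v1" using ind[OF e(1)] by blast
    obtain i2 where i2: "i2 < n" "v i2 = v2" "w i2 = f v2" using ind[OF e(2)] by blast
    obtain i3 where i3: "i3 < n" "v i3 = v3" "w i3 = f v3" using ind[OF e(3)] by blast
    obtain i4 where i4: "i4 < n" "v i4 = v4" "w i4 = f v4" using ind[OF e(4)] by blast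
    have t: "triangle v1 v2 v3" by (rule extreme_triangle[OF e(1,2,3) d(1,2,4)])
    have t': "triangle (f v1) (f v2) (f v3)" by (rule extreme_triangle[OF e'(1,2,3) d'(1,2,4)])
    have t4': "triangle (f v4) (f v2) (f v1)"
      by (rule extreme_triangle[OF e'(4,2,1)]) (use d' in auto)
    obtain X where X: "X \<in> closed_segment v4 v2" "X \<in> closed_segment v1 v3"
      using quadrilateral(3) by blast
    obtain X' where ty1: "same_type {..<Suc n} (betweenness_struct P) (v(n := X)) (betweenness_struct Q) (w(n := X'))"
      and X': "X' \<in> closed_segment (f v4) (f v2)" "X' \<in> closed_segment (f v1) (f v3)"
      using crossing_extend[OF ty i4(1) i2(1) i1(1) i3(1) cP(1), unfolded i1 i2 i3 i4, OF eK(4,2) t4' X]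
      by blast
    obtain x where x: "x > 0" "X = pt v4 v2 x"
      using crossing_pt[OF e(4,2) eK(1,3) _ _ _ _ X] d by metis
    obtain y where y: "y > 0" "X = pt v1 v3 y"
      using crossing_pt[OF e(1,3) eK(4,2) _ _ _ _ X(2,1)] d by metis
    obtain x' where x': "x' > 0" "X' = pt (f v4) (f v2) x'"
      using crossing_pt[OF e'(4,2) eK'(1,3) _ _ _ _ X'] d' by metis
    obtain y' where y': "y' > 0" "X' = pt (f v1) (f v3) y'"
      using crossing_pt[OF e'(1,3) eK'(4,2) _ _ _ _ X'(2,1)] d' by metis
    \<comment> \<open>By \<open>crossing_coords\<close>, \<open>v4\<close> has coordinates
      \<open>k\<close>, \<open>- x\<close>, \<open>k * y\<close> in \<open>v1\<close>,
      \<open>v2\<close>, \<open>v3\<close>, and \<open>f v4\<close> has the primed ones.\<close>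
    define k k' where "k = (1 + x) / (1 + y)" and "k' = (1 + x') / (1 + y')"
    have kpos: "k > 0" "k' > 0" unfolding k_def k'_def using x y x' y' by auto
    \<comment> \<open>The factors are the quotients of the coordinates of \<open>f v4\<close> by
      those of \<open>v4\<close>, so that \<open>A\<close> matches the fourth vertex as well; all
      are positive.\<close>
    obtain A :: "real^3^3" where A: "invertible A"
      "A *v lift v1 = (k' / k) *\<^sub>R lift (f v1)" "A *v lift v2 = (x' / x) *\<^sub>R lift (f v2)"
      "A *v lift v3 = (k' * y' / (k * y)) *\<^sub>R lift (f v3)"
      using matrix_exists[OF t t', of "k' / k" "x' / x" "k' * y' / (k * y)"] kpos x y x' y' by auto
    have lin: "A *v (a *\<^sub>R lift v1 + b *\<^sub>R lift v2 + c *\<^sub>R lift v3) =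
      (a * (k' / k)) *\<^sub>R lift (f v1) + (b * (x' / x)) *\<^sub>R lift (f v2) + (c * (k' * y' / (k * y))) *\<^sub>R lift (f v3)"
      for a b c
      by (simp add: matrix_vector_right_distrib matrix_vector_mult_scaleR A(2-4))
    have A4: "A *v lift v4 = lift (f v4)"
    proof -
      have v4: "lift v4 = k *\<^sub>R lift v1 + (- x) *\<^sub>R lift v2 + (k * y) *\<^sub>R lift v3"
        unfolding k_def by (rule crossing_coords) (use x y in auto)
      have "k * (k' / k) = k'" "- x * (x' / x) = - x'" "k * y * (k' * y' / (k * y)) = k' * y'"
        using kpos x y by simp_all
      then have "A *v lift v4 = k' *\<^sub>R lift (f v1) + (- x') *\<^sub>R lift (f v2) + (k' * y') *\<^sub>R lift (f v3)"
        by (simp only: v4 lin)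
      also have "\<dots> = lift (f v4)"
        unfolding k'_def by (rule crossing_coords[symmetric]) (use x' y' in auto)
      finally show ?thesis .
    qed
    show ?thesis
    proof (rule projectively_equivalentI[OF cP(1) cQ(1) cP(4) cQ(4) A(1) im])
      fix r assume "r \<in> ?E"
      then have r: "r extreme_point_of P" by simp
      show "\<exists>c>0. A *v lift r = c *\<^sub>R lift (f r)"
      proof (cases "r \<in> {v1, v2, v3, v4}")
        case True
        have "k' / k > 0" "x' / x > 0" "k' * y' / (k * y) > 0" using kpos x y x' y' by auto
        then have "\<exists>c>0. A *v lift v1 = c *\<^sub>R lift (f v1)" "\<exists>c>0. A *v lift v2 = c *\<^sub>R lift (f v2)"
          "\<exists>c>0. A *v lift v3 = c *\<^sub>R lift (f v3)" using A(2-4) by blast+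
        moreover have "\<exists>c>0. A *v lift v4 = c *\<^sub>R lift (f v4)"
          using A4 by (intro exI[of _ 1]) simp
        ultimately show ?thesis using True by blast
      next
        case False
        then have dr: "r \<noteq> v1" "r \<noteq> v2" "r \<noteq> v3" "r \<noteq> v4" by auto
        have r': "f r extreme_point_of Q" by (rule fQ[OF r])
        have dr': "f r \<noteq> f v1" "f r \<noteq> f v2" "f r \<noteq> f v3" "f r \<noteq> f v4"
          using fne r e dr by blast+
        obtain ir where ir: "ir < n" "v ir = r" "w ir = f r" using ind[OF r] by blast
        have upd: "(v(n := X)) i1 = v1" "(v(n := X)) i2 = v2" "(v(n := X)) i3 = v3" "(v(n := X)) i4 = v4"
          "(v(n := X)) ir = r" "(v(n := X)) n = X"
          "(w(n := X')) i1 = f v1" "(w(n := X')) i2 = f v2" "(w(n := X')) i3 = f v3" "(w(n := X')) i4 = f v4"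
          "(w(n := X')) ir = f r" "(w(n := X')) n = X'"
          using i1 i2 i3 i4 ir by auto
        have lt: "i1 < Suc n" "i2 < Suc n" "i3 < Suc n" "i4 < Suc n" "ir < Suc n" "n < Suc n"
          using i1 i2 i3 i4 ir by auto
        note meet = quadrilateral(4)[OF r False]
        obtain s s' where s: "s > 0" "s' > 0" "s / x = s' / x'"
          "pt v4 v2 s \<in> closed_segment v1 r" "pt (f v4) (f v2) s' \<in> closed_segment (f v1) (f r)"
          using crossing_ratio[OF poly ty1 lt(4,2,1,5,6), unfolded upd,
              OF e(4,2) eK(1) extreme_in[OF r] d(5)[symmetric] d(3)[symmetric] dr(4)[symmetric]
              d(1)[symmetric] dr(2)[symmetric] e'(4,2,1) extreme_in[OF r'] d'(5)[symmetric] d'(3)[symmetric]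
              dr'(4)[symmetric] d'(1)[symmetric] dr'(2)[symmetric] x(2,1) x'(2,1) meet[THEN conjunct1]]
          by blast
        obtain t t' where t: "t > 0" "t' > 0" "t / y = t' / y'"
          "pt v1 v3 t \<in> closed_segment v2 r" "pt (f v1) (f v3) t' \<in> closed_segment (f v2) (f r)"
          using crossing_ratio[OF poly ty1 lt(1,3,2,5,6), unfolded upd,
              OF e(1,3) eK(2) extreme_in[OF r] d(2) d(1) dr(1)[symmetric]
              d(4)[symmetric] dr(3)[symmetric] e'(1,3,2) extreme_in[OF r'] d'(2) d'(1)
              dr'(1)[symmetric] d'(4)[symmetric] dr'(3)[symmetric] y(2,1) y'(2,1) meet[THEN conjunct2]]
          by blast
        have sne: "pt v4 v2 s \<noteq> v1" "pt (f v4) (f v2) s' \<noteq> f v1"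
          using pt_in_segment[of s v4 v2] pt_in_segment[of s' "f v4" "f v2"] s(1,2)
            extreme_not_between[OF e(1) eK(4,2)] extreme_not_between[OF e'(1) eK'(4,2)] d d' by auto
        have tne: "pt v1 v3 t \<noteq> v2" "pt (f v1) (f v3) t' \<noteq> f v2"
          using pt_in_segment[of t v1 v3] pt_in_segment[of t' "f v1" "f v3"] t(1,2)
            extreme_not_between[OF e(2) eK(1,3)] extreme_not_between[OF e'(2) eK'(1,3)] d d' by auto
        obtain z where z: "z > 0"
          "lift r = z *\<^sub>R ((k * y / t) *\<^sub>R lift v1 + (s - x) *\<^sub>R lift v2 + (k * y) *\<^sub>R lift v3)"
          using vertex_coords[OF \<open>triangle v1 v2 v3\<close> _ x(1) y(1) s(4) sne(1) s(1) t(4) tne(1) t(1) k_def]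
            x(2) y(2) by metis
        obtain z' where z': "z' > 0"
          "lift (f r) = z' *\<^sub>R ((k' * y' / t') *\<^sub>R lift (f v1) + (s' - x') *\<^sub>R lift (f v2) + (k' * y') *\<^sub>R lift (f v3))"
          using vertex_coords[OF t' _ x'(1) y'(1) s(5) sne(2) s(2) t(5) tne(2) t(2) k'_def]
            x'(2) y'(2) by metis
        \<comment> \<open>The invariance of the cross ratios, \<open>s / x = s' / x'\<close> and
          \<open>t / y = t' / y'\<close>, is exactly what turns the rescaled coordinates of
          \<open>r\<close> into those of \<open>f r\<close>.\<close>
        have c1: "k * y / t * (k' / k) = k' * y' / t'" using t(1-3) kpos y y' by (simp add: field_simps)
        have c2: "(s - x) * (x' / x) = s' - x'" using s(1-3) x x' by (simp add: field_simps)
        have c3: "k * y * (k' * y' / (k * y)) = k' * y'" using kpos y by simp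
        have "A *v lift r = z *\<^sub>R (A *v ((k * y / t) *\<^sub>R lift v1 + (s - x) *\<^sub>R lift v2 + (k * y) *\<^sub>R lift v3))"
          unfolding z(2) by (rule matrix_vector_mult_scaleR)
        also have "\<dots> = (z / z') *\<^sub>R lift (f r)"
          unfolding lin c1 c2 c3 z'(2) using z' by simp
        finally show ?thesis using z(1) z'(1) by (intro exI[of _ "z / z'"]) simp
      qed
    qed
  qed
qed

theorem proposition9p19:
  fixes P Q :: "(real^2) set"
  assumes "convex_polygon P" and "convex_polygon Q"
  shows "elementarily_equivalent (betweenness_struct P) (betweenness_struct Q) \<longleftrightarrow>
         projectively_equivalent P Q"
proof
  assume "elementarily_equivalent (betweenness_struct P) (betweenness_struct Q)"
  then show "projectively_equivalent P Q"
    by (rule elementarily_imp_projectively_equivalent[OF assms])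
next
  assume "projectively_equivalent P Q"
  moreover have "convex P" "P \<noteq> {}"
    using convex_polygon_vertices[OF assms(1)] by auto
  ultimately show "elementarily_equivalent (betweenness_struct P) (betweenness_struct Q)"
    by (rule projectively_imp_elementarily_equivalent)
qed

end
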